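(* Let $\Sigma$ be a compact surface with an Oxtoby-Ulam probability measure $\mu$, and let $F\colon\Sigma\to\Sigma$ be a measurable pseudo-Anosov map whose invariant turbulations $(\mathcal{T}^s,\nu^s)$, $(\mathcal{T}^u,\nu^u)$ satisfy the tartan connection hypothesis. Then $F$ is ergodic with respect to $\mu$.
   Context: Setting. $\Sigma$ is a compact surface and $\mu$ is an Oxtoby-Ulam (OU) measure on $\Sigma$: a Borel measure which is non-atomic, positive on non-empty open sets, and satisfies $\mu(\partial\Sigma)=0$; moreover $\mu(\Sigma)=1$. Measured turbulations. An immersed line is a continuous injective image of $\mathbb{R}$ in $\Sigma$ (with the topology of $\mathbb{R}$). A measured turbulation $(\mathcal{T},\nu)$ on $\Sigma$ is a partition of a full $\mu$-measure Borel subset of $\Sigma$ into immersed lines called streamlines, together with, on each streamline $\ell$, an OU measure $\nu_\ell$ (the stream measure: Borel, non-atomic, positive on non-empty open subsets of $\ell$) which is finite on closed arcs of $\ell$. It has dense streamlines if every streamline is dense in $\Sigma$. For distinct points $x,y$ of a streamline $\ell$, $[x,y]$ denotes the closed arc of $\ell$ with endpoints $x,y$; closed, half-open and open such arcs are called stream arcs, and the measure of a stream arc is its stream measure. $(\mathcal{T},\nu)$ is tame if, for a metric $d$ compatible with the topology of $\Sigma$ (the choice is irrelevant), for every $\epsilon>0$ there is $\delta>0$ such that every stream arc $[x,y]$ with $\nu([x,y])<\delta$ has $d(x,y)<\epsilon$. Two measured turbulations are transverse if there is a full $\mu$-measure subset of $\Sigma$ every point $x$ of which lies in streamlines $\ell,\ell'$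 of the two turbulations which intersect (topologically) transversely at $x$. Tartans. Let $(\mathcal{T}^s,\nu^s)$, $(\mathcal{T}^u,\nu^u)$ be a transverse pair of measured turbulations, called stable and unstable. A tartan $R=(R^s,R^u)$ consists of Borel subsets $R^s,R^u$ of $\Sigma$ which are disjoint unions of stable and unstable stream arcs respectively (called the stable and unstable fibers of $R$), such that: (a) every arc of $R^s$ intersects every arc of $R^u$ exactly once, either transversely or at an endpoint of one or both arcs; (b) the arcs can be oriented so that every arc of $R^s$ (respectively $R^u$) crosses the arcs of $R^u$ (respectively $R^s$) in the same order; (c) the measures of the arcs of $R^s$ and $R^u$ are bounded above; (d) some open topological disk in $\Sigma$ contains $R^s\cup R^u$. Write $R^\pitchfork=R^s\cap R^u$; $R$ is a positive measure tartan if $\mu(R^\pitchfork)>0$. For $x\in R^\pitchfork$, $\mathfrak{s}(x)$ and $\mathfrak{u}(x)$ are the stable and unstable fibers of $R$ containing $x$; for a stable fiber $\mathfrak{s}$ and unstable fiber $\mathfrak{u}$, $\mathfrak{s}\pitchfork\mathfrak{u}=\mathfrak{u}\pitchfork\mathfrak{s}$ is their unique intersection point, $E^{\mathfrak{s}}=\mathfrak{s}\cap R^\pitchfork$, $E^{\mathfrak{u}}=\mathfrak{u}\cap R^\pitchfork$, and $\nu_{\mathfrak{s}},\nu_{\mathfrak{u}}$ are the restrictions of the stream measures to $E^{\mathfrak{s}},E^{\mathfrak{u}}$. $R$ is compatible if, for all stable and unstable fibers $\mathfrak{s},\mathfrak{u}$ of $R$, the bijection $\psi^{\mathfrak{s},\mathfrak{u}}\colon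 E^{\mathfrak{s}}\times E^{\mathfrak{u}}\to R^\pitchfork$, $(x,y)\mapsto\mathfrak{u}(x)\pitchfork\mathfrak{s}(y)$, is bi-measurable and $\psi^{\mathfrak{s},\mathfrak{u}}_*(\nu_{\mathfrak{s}}\times\nu_{\mathfrak{u}})=\mu|_{R^\pitchfork}$. Fullness. The transverse pair is full if (a) there is a countable collection $R_i$ of positive measure compatible tartans with $\mu(\bigcup_i R_i^\pitchfork)=1$; and (b) for every non-empty open $U\subset\Sigma$ there is a positive measure compatible tartan $R$ with $R^s\cup R^u\subset U$. Measurable pseudo-Anosov maps. A pair $(\mathcal{T}^s,\nu^s),(\mathcal{T}^u,\nu^u)$ are measurable pseudo-Anosov turbulations if they are transverse, tame, full, and have dense streamlines. For a $\mu$-preserving homeomorphism $F\colon\Sigma\to\Sigma$, $F(\mathcal{T},\nu)$ is the measured turbulation with streamlines $F(\ell)$, $\ell\in\mathcal{T}$, and measure $F_*(\nu_\ell)$ on $F(\ell)$. $F$ is measurable pseudo-Anosov if there are measurable pseudo-Anosov turbulations $(\mathcal{T}^s,\nu^s),(\mathcal{T}^u,\nu^u)$ (its invariant turbulations) and a number $\lambda>1$ (the dilatation) such that $F(\mathcal{T}^s,\nu^s)=(\mathcal{T}^s,\lambda\nu^s)$ and $F(\mathcal{T}^u,\nu^u)=(\mathcal{T}^u,\lambda^{-1}\nu^u)$. (So $F$ contracts stable stream measure and expands unstable stream measure by the factor $\lambda$.) Tartan connection hypothesis. Measurable pseudo-Anosov turbulations $(\mathcal{T}^s,\nu^s),(\mathcal{T}^u,\nu^u)$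 satisfy the tartan connection hypothesis if for any compatible positive measure tartans $R$ and $S$, the stable streamlines containing fibers of $R$ intersect the unstable streamlines containing fibers of $S$ in positive measure; that is, the intersection of the union of all stable streamlines containing a stable fiber of $R$ with the union of all unstable streamlines containing an unstable fiber of $S$ has positive $\mu$-measure. *)

theory Defs
  imports "HOL-Probability.Probability"
begin

section \<open>Surfaces and Oxtoby-Ulam measures\<close>

text \<open>The surface is the whole carrier type; its class \<open>metric_space\<close> provides the topology together
  with a compatible metric. Surfaces may have boundary.\<close>

definition compact_surface :: "'a::metric_space itself \<Rightarrow> bool" where
  "compact_surface _ \<longleftrightarrow>
     compact (UNIV :: 'a set) \<and>
     (\<forall>x::'a. \<exists>U V. open U \<and> x \<in> U \<and>
        openin (top_of_set {p::real \<times> real. 0 \<le> snd p}) V \<and> U homeomorphic V)"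

definition surface_boundary :: "'a::metric_space set" where
  "surface_boundary =
     {x. \<not> (\<exists>U. open U \<and> x \<in> U \<and> U homeomorphic (UNIV :: (real \<times> real) set))}"

definition nonatomic :: "'a measure \<Rightarrow> bool" where
  "nonatomic M \<longleftrightarrow>
     (\<forall>A\<in>sets M. 0 < emeasure M A \<longrightarrow>
        (\<exists>B\<in>sets M. B \<subseteq> A \<and> 0 < emeasure M B \<and> emeasure M B < emeasure M A))"

definition OU_measure :: "'a::metric_space measure \<Rightarrow> bool" where
  "OU_measure \<mu> \<longleftrightarrow>
     sets \<mu> = sets borel \<and> nonatomic \<mu> \<and>
     (\<forall>U. open U \<and> U \<noteq> {} \<longrightarrow> 0 < emeasure \<mu> U) \<and>
     emeasure \<mu> surface_boundary = 0"

section \<open>Measured turbulations\<close>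

text \<open>A streamline is a topology \<open>X\<close> whose points form a subset of the surface: the line topology is
  part of the data, being in general neither the subspace topology nor determined by the underlying
  set (a figure eight is an injective image of the real line in two ways).\<close>

definition line_param :: "'a::metric_space topology \<Rightarrow> (real \<Rightarrow> 'a) \<Rightarrow> bool" where
  "line_param X \<phi> \<longleftrightarrow> continuous_on UNIV \<phi> \<and> homeomorphic_map euclideanreal X \<phi>"

definition immersed_line :: "'a::metric_space topology \<Rightarrow> bool" where
  "immersed_line X \<longleftrightarrow> (\<exists>\<phi>. line_param X \<phi>)"

definition borel_on :: "'a topology \<Rightarrow> 'a measure" where
  "borel_on X = sigma (topspace X) {U. openin X U}"

definition closed_arc :: "'a::metric_space topology \<Rightarrow> 'a \<Rightarrow> 'a \<Rightarrow> 'a set \<Rightarrow> bool" where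
  "closed_arc X x y A \<longleftrightarrow>
     (\<exists>\<phi> a b. line_param X \<phi> \<and> a < b \<and> \<phi> a = x \<and> \<phi> b = y \<and> A = \<phi> ` {a..b})"

text \<open>Closed, open and half-open arcs with distinct end points \<open>x\<close>, \<open>y\<close>, which need not belong to the
  arc.\<close>

definition arc_between :: "'a::metric_space topology \<Rightarrow> 'a \<Rightarrow> 'a \<Rightarrow> 'a set \<Rightarrow> bool" where
  "arc_between X x y A \<longleftrightarrow>
     (\<exists>\<phi> a b. line_param X \<phi> \<and> a < b \<and> \<phi> a = x \<and> \<phi> b = y \<and>
        A \<in> {\<phi> ` {a..b}, \<phi> ` {a<..<b}, \<phi> ` {a..<b}, \<phi> ` {a<..b}})"

definition stream_arc :: "'a::metric_space topology \<Rightarrow> 'a set \<Rightarrow> bool" where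
  "stream_arc X A \<longleftrightarrow> (\<exists>x y. arc_between X x y A)"

definition arc_endpoint :: "'a::metric_space topology \<Rightarrow> 'a set \<Rightarrow> 'a \<Rightarrow> bool" where
  "arc_endpoint X A x \<longleftrightarrow> (\<exists>y. arc_between X x y A \<or> arc_between X y x A)"

definition stream_measure :: "'a::metric_space topology \<Rightarrow> 'a measure \<Rightarrow> bool" where
  "stream_measure X \<nu> \<longleftrightarrow>
     sets \<nu> = sets (borel_on X) \<and> nonatomic \<nu> \<and>
     (\<forall>U. openin X U \<and> U \<noteq> {} \<longrightarrow> 0 < emeasure \<nu> U) \<and>
     (\<forall>x y A. closed_arc X x y A \<longrightarrow> emeasure \<nu> A < \<infinity>)"

text \<open>A measured turbulation is the set of its streamlines, each paired with its stream measure. As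
  distinct pairs have disjoint underlying sets, every streamline carries exactly one measure.\<close>

type_synonym 'a turbulation = "('a topology \<times> 'a measure) set"

definition turbulation_support :: "'a turbulation \<Rightarrow> 'a set" where
  "turbulation_support T = (\<Union>(X, \<nu>)\<in>T. topspace X)"

definition measured_turbulation :: "'a::metric_space measure \<Rightarrow> 'a turbulation \<Rightarrow> bool" where
  "measured_turbulation \<mu> T \<longleftrightarrow>
     (\<forall>(X, \<nu>)\<in>T. immersed_line X \<and> stream_measure X \<nu>) \<and>
     (\<forall>p\<in>T. \<forall>q\<in>T. p \<noteq> q \<longrightarrow> topspace (fst p) \<inter> topspace (fst q) = {}) \<and>
     turbulation_support T \<in> sets borel \<and>
     emeasure \<mu> (- turbulation_support T) = 0"

definition dense_streamlines :: "'a::metric_space turbulation \<Rightarrow> bool" where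
  "dense_streamlines T \<longleftrightarrow> (\<forall>(X, \<nu>)\<in>T. closure (topspace X) = UNIV)"

definition tame :: "'a::metric_space turbulation \<Rightarrow> bool" where
  "tame T \<longleftrightarrow>
     (\<forall>\<epsilon>>0. \<exists>\<delta>>0. \<forall>(X, \<nu>)\<in>T. \<forall>x y A.
        closed_arc X x y A \<and> emeasure \<nu> A < ennreal \<delta> \<longrightarrow> dist x y < \<epsilon>)"

text \<open>Topological transversality: near \<open>x\<close> the pair of lines looks like the pair of coordinate axes
  in the plane. Only the local branches \<open>\<alpha>\<close>, \<open>\<beta>\<close> through \<open>x\<close> matter; the lines may return to \<open>U\<close>.\<close>

definition transverse_at :: "'a::metric_space topology \<Rightarrow> 'a topology \<Rightarrow> 'a \<Rightarrow> bool" where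
  "transverse_at X Y x \<longleftrightarrow>
     (\<exists>U h k \<alpha> \<beta>. open U \<and> x \<in> U \<and>
        homeomorphism U (UNIV :: (real \<times> real) set) h k \<and> h x = (0, 0) \<and>
        stream_arc X \<alpha> \<and> openin X \<alpha> \<and> \<alpha> \<subseteq> U \<and> h ` \<alpha> = UNIV \<times> {0} \<and>
        stream_arc Y \<beta> \<and> openin Y \<beta> \<and> \<beta> \<subseteq> U \<and> h ` \<beta> = {0} \<times> UNIV)"

definition transverse_pair ::
    "'a::metric_space measure \<Rightarrow> 'a turbulation \<Rightarrow> 'a turbulation \<Rightarrow> bool" where
  "transverse_pair \<mu> Ts Tu \<longleftrightarrow>
     (AE x in \<mu>. \<exists>(X, \<nu>)\<in>Ts. \<exists>(Y, \<nu>')\<in>Tu.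
        x \<in> topspace X \<and> x \<in> topspace Y \<and> transverse_at X Y x)"

section \<open>Tartans\<close>

text \<open>A tartan is given by its two families of fibers.\<close>

record 'a tartan =
  stable_fibers :: "'a set set"
  unstable_fibers :: "'a set set"

definition stable_part :: "'a tartan \<Rightarrow> 'a set" where
  "stable_part R = \<Union>(stable_fibers R)"

definition unstable_part :: "'a tartan \<Rightarrow> 'a set" where
  "unstable_part R = \<Union>(unstable_fibers R)"

definition crossing_set :: "'a tartan \<Rightarrow> 'a set" where
  "crossing_set R = stable_part R \<inter> unstable_part R"

text \<open>The streamline containing a given non-empty arc, and its stream measure.\<close>

definition line_of :: "'a turbulation \<Rightarrow> 'a set \<Rightarrow> 'a topology" where
  "line_of T A = fst (THE p. p \<in> T \<and> A \<subseteq> topspace (fst p))"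

definition measure_of_line :: "'a turbulation \<Rightarrow> 'a set \<Rightarrow> 'a measure" where
  "measure_of_line T A = snd (THE p. p \<in> T \<and> A \<subseteq> topspace (fst p))"

text \<open>\<open>coherently_ordered T \<A> \<B>\<close>: an orientation of an arc is given by a parametrization of the
  streamline containing it, and with suitable orientations all arcs in \<open>\<A>\<close> cross those in \<open>\<B>\<close> in the
  same order.\<close>

definition crosses_before :: "(real \<Rightarrow> 'a) \<Rightarrow> 'a set \<Rightarrow> 'a set \<Rightarrow> 'a set \<Rightarrow> bool" where
  "crosses_before \<phi> A B B' \<longleftrightarrow> (\<exists>s t. s < t \<and> \<phi> s \<in> A \<inter> B \<and> \<phi> t \<in> A \<inter> B')"

definition coherently_ordered ::
    "'a::metric_space turbulation \<Rightarrow> 'a set set \<Rightarrow> 'a set set \<Rightarrow> bool" where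
  "coherently_ordered T \<A> \<B> \<longleftrightarrow>
     (\<exists>\<phi>. (\<forall>A\<in>\<A>. line_param (line_of T A) (\<phi> A)) \<and>
        (\<forall>A\<in>\<A>. \<forall>A'\<in>\<A>. \<forall>B\<in>\<B>. \<forall>B'\<in>\<B>.
           crosses_before (\<phi> A) A B B' \<longleftrightarrow> crosses_before (\<phi> A') A' B B'))"

definition is_tartan ::
    "'a::metric_space turbulation \<Rightarrow> 'a turbulation \<Rightarrow> 'a tartan \<Rightarrow> bool" where
  "is_tartan Ts Tu R \<longleftrightarrow>
     stable_part R \<in> sets borel \<and> unstable_part R \<in> sets borel \<and>
     disjoint (stable_fibers R) \<and> disjoint (unstable_fibers R) \<and>
     (\<forall>A\<in>stable_fibers R. \<exists>(X, \<nu>)\<in>Ts. stream_arc X A) \<and>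
     (\<forall>B\<in>unstable_fibers R. \<exists>(Y, \<nu>)\<in>Tu. stream_arc Y B) \<and>
     (\<forall>A\<in>stable_fibers R. \<forall>B\<in>unstable_fibers R. \<exists>x. A \<inter> B = {x} \<and>
        (transverse_at (line_of Ts A) (line_of Tu B) x \<or>
         arc_endpoint (line_of Ts A) A x \<or> arc_endpoint (line_of Tu B) B x)) \<and>
     coherently_ordered Ts (stable_fibers R) (unstable_fibers R) \<and>
     coherently_ordered Tu (unstable_fibers R) (stable_fibers R) \<and>
     (\<exists>K<\<infinity>. (\<forall>A\<in>stable_fibers R. emeasure (measure_of_line Ts A) A \<le> K) \<and>
            (\<forall>B\<in>unstable_fibers R. emeasure (measure_of_line Tu B) B \<le> K)) \<and>
     (\<exists>D. open D \<and> D homeomorphic (ball 0 1 :: (real \<times> real) set) \<and>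
        stable_part R \<union> unstable_part R \<subseteq> D)"

definition fiber_through :: "'a set set \<Rightarrow> 'a \<Rightarrow> 'a set" where
  "fiber_through \<A> x = (THE A. A \<in> \<A> \<and> x \<in> A)"

definition tartan_chart :: "'a tartan \<Rightarrow> 'a \<times> 'a \<Rightarrow> 'a" where
  "tartan_chart R = (\<lambda>(x, y).
     the_elem (fiber_through (unstable_fibers R) x \<inter> fiber_through (stable_fibers R) y))"

definition fiber_trace_measure :: "'a turbulation \<Rightarrow> 'a tartan \<Rightarrow> 'a set \<Rightarrow> 'a measure" where
  "fiber_trace_measure T R A = restrict_space (measure_of_line T A) (A \<inter> crossing_set R)"

definition compatible_tartan ::
    "'a::metric_space measure \<Rightarrow> 'a turbulation \<Rightarrow> 'a turbulation \<Rightarrow> 'a tartan \<Rightarrow> bool" where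
  "compatible_tartan \<mu> Ts Tu R \<longleftrightarrow>
     is_tartan Ts Tu R \<and>
     (\<forall>A\<in>stable_fibers R. \<forall>B\<in>unstable_fibers R.
        let E = (A \<inter> crossing_set R) \<times> (B \<inter> crossing_set R);
            P = fiber_trace_measure Ts R A \<Otimes>\<^sub>M fiber_trace_measure Tu R B;
            M = restrict_space \<mu> (crossing_set R);
            \<psi> = tartan_chart R
        in bij_betw \<psi> E (crossing_set R) \<and>
           \<psi> \<in> measurable P M \<and> the_inv_into E \<psi> \<in> measurable M P \<and>
           distr P M \<psi> = M)"

definition positive_measure_tartan :: "'a measure \<Rightarrow> 'a tartan \<Rightarrow> bool" where
  "positive_measure_tartan \<mu> R \<longleftrightarrow> 0 < emeasure \<mu> (crossing_set R)"

definition full_pair ::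
    "'a::metric_space measure \<Rightarrow> 'a turbulation \<Rightarrow> 'a turbulation \<Rightarrow> bool" where
  "full_pair \<mu> Ts Tu \<longleftrightarrow>
     (\<exists>\<R>. countable \<R> \<and>
        (\<forall>R\<in>\<R>. compatible_tartan \<mu> Ts Tu R \<and> positive_measure_tartan \<mu> R) \<and>
        emeasure \<mu> (\<Union>R\<in>\<R>. crossing_set R) = 1) \<and>
     (\<forall>U. open U \<and> U \<noteq> {} \<longrightarrow>
        (\<exists>R. compatible_tartan \<mu> Ts Tu R \<and> positive_measure_tartan \<mu> R \<and>
           stable_part R \<union> unstable_part R \<subseteq> U))"

section \<open>Measurable pseudo-Anosov maps\<close>

definition pseudo_Anosov_turbulations ::
    "'a::metric_space measure \<Rightarrow> 'a turbulation \<Rightarrow> 'a turbulation \<Rightarrow> bool" where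
  "pseudo_Anosov_turbulations \<mu> Ts Tu \<longleftrightarrow>
     measured_turbulation \<mu> Ts \<and> measured_turbulation \<mu> Tu \<and>
     transverse_pair \<mu> Ts Tu \<and> tame Ts \<and> tame Tu \<and>
     full_pair \<mu> Ts Tu \<and> dense_streamlines Ts \<and> dense_streamlines Tu"

text \<open>For a bijection \<open>F\<close>, pulling the line topology back along \<open>inv F\<close> transports it to the image of
  the line under \<open>F\<close>.\<close>

definition image_line :: "('a \<Rightarrow> 'a) \<Rightarrow> 'a topology \<Rightarrow> 'a topology" where
  "image_line F X = pullback_topology UNIV (inv F) X"

definition image_turbulation :: "('a \<Rightarrow> 'a) \<Rightarrow> 'a turbulation \<Rightarrow> 'a turbulation" where
  "image_turbulation F T =
     (\<lambda>(X, \<nu>). (image_line F X, distr \<nu> (borel_on (image_line F X)) F)) ` T"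

definition scale_turbulation :: "real \<Rightarrow> 'a turbulation \<Rightarrow> 'a turbulation" where
  "scale_turbulation c T = (\<lambda>(X, \<nu>). (X, scale_measure (ennreal c) \<nu>)) ` T"

definition measure_preserving :: "'a measure \<Rightarrow> ('a \<Rightarrow> 'a) \<Rightarrow> bool" where
  "measure_preserving M F \<longleftrightarrow> F \<in> measurable M M \<and> distr M M F = M"

definition measurable_pseudo_Anosov ::
    "'a::metric_space measure \<Rightarrow> ('a \<Rightarrow> 'a) \<Rightarrow> 'a turbulation \<Rightarrow> 'a turbulation \<Rightarrow> real \<Rightarrow> bool"
  where
  "measurable_pseudo_Anosov \<mu> F Ts Tu c \<longleftrightarrow>
     homeomorphic_map euclidean euclidean F \<and> measure_preserving \<mu> F \<and>
     pseudo_Anosov_turbulations \<mu> Ts Tu \<and> 1 < c \<and>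
     image_turbulation F Ts = scale_turbulation c Ts \<and>
     image_turbulation F Tu = scale_turbulation (inverse c) Tu"

definition streamlines_containing :: "'a turbulation \<Rightarrow> 'a set set \<Rightarrow> 'a set" where
  "streamlines_containing T \<A> = \<Union>{topspace X | X \<nu>. (X, \<nu>) \<in> T \<and> (\<exists>A\<in>\<A>. A \<subseteq> topspace X)}"

text \<open>The intersection below is not required to be Borel, so its positivity is expressed by the
  outer measure, which is the measure itself on measurable sets (\<open>emeasure\<close> would be 0 on
  non-measurable ones).\<close>

definition tartan_connection_hypothesis ::
    "'a::metric_space measure \<Rightarrow> 'a turbulation \<Rightarrow> 'a turbulation \<Rightarrow> bool" where
  "tartan_connection_hypothesis \<mu> Ts Tu \<longleftrightarrow>
     (\<forall>R S. compatible_tartan \<mu> Ts Tu R \<and> positive_measure_tartan \<mu> R \<and>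
            compatible_tartan \<mu> Ts Tu S \<and> positive_measure_tartan \<mu> S \<longrightarrow>
        0 < outer_measure_of \<mu>
              (streamlines_containing Ts (stable_fibers R) \<inter>
               streamlines_containing Tu (unstable_fibers S)))"

definition ergodic :: "'a measure \<Rightarrow> ('a \<Rightarrow> 'a) \<Rightarrow> bool" where
  "ergodic M F \<longleftrightarrow>
     measure_preserving M F \<and>
     (\<forall>A\<in>sets M. F -` A \<inter> space M = A \<longrightarrow> emeasure M A = 0 \<or> emeasure M (space M - A) = 0)"

end

theory Submission
  imports Defs
begin

text \<open>
  This is a Hopf argument in which tartans are cut down to the fibers that lie in a set saturated by
  streamlines. Let \<open>A\<close> be invariant under \<open>F\<close>. The heart of the matter is that \<open>A\<close> agrees almost everywhere with
  a Borel set \<open>P\<close> that is a union of stable streamlines, up to points on no streamline, and also with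
  a Borel set \<open>Q\<close> that is such a union of unstable streamlines (\<open>saturated_representative\<close>).

  To find \<open>P\<close>, choose continuous functions \<open>g\<^sub>k\<close> which differ from the indicator of \<open>A\<close> only on a set of
  measure below \<open>1 / 2 ^ k\<close>. As \<open>A\<close> is invariant and \<open>F\<close> preserves the measure, \<open>g\<^sub>k\<close>
  composed with any iterate of \<open>F\<close> differs from that indicator on a set of the same measure. By the
  Borel-Cantelli lemma, the compositions with iterates of arbitrarily chosen orders \<open>N\<^sub>k\<close> converge to
  the indicator almost everywhere. Let \<open>N\<^sub>k\<close> be so large that the iterate shrinks every stable arc of
  stream measure at most \<open>k\<close> to one whose end points are so close that \<open>g\<^sub>k\<close> varies by less than
  \<open>1 / (k + 1)\<close> between them; this is possible by tameness and the contraction of stable stream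
  measure. Then two points of one stable streamline have the same limit behaviour, and the set of
  points where the limit is 1 can serve as \<open>P\<close>. The inverse of \<open>F\<close>, which contracts the unstable
  streamlines, gives \<open>Q\<close>.

  Suppose now that neither \<open>A\<close> nor its complement is null. By fullness, one compatible tartan \<open>R\<close> has
  crossing points in \<open>A\<close> of positive measure, and another one, \<open>S\<close>, in the complement. Keep only the
  stable fibers of \<open>R\<close> inside \<open>P\<close>, and only the unstable fibers of \<open>S\<close> outside \<open>Q\<close>. Because \<open>P\<close> and \<open>Q\<close> are
  saturated, this merely intersects the crossing sets with \<open>P\<close> and with the complement of \<open>Q\<close>, and the
  product structure restricts to sub-rectangles, so that both subtartans are again
  compatible and of positive measure (\<open>compatible_subtartan\<close>). The connection hypothesis makes the
  stable streamlines of the first and the unstable streamlines of the second meet in positive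
  measure. But they meet inside \<open>P - Q\<close>, which is null since \<open>P\<close> and \<open>Q\<close> both agree with \<open>A\<close>.
\<close>

section \<open>Continuous functions equal to an indicator off a small set\<close>

text \<open>The sets with this property form a \<open>\<sigma>\<close>-algebra: complements correspond to \<open>1 - g\<close>, and finite unions
  to one minus the product of the \<open>1 - g\<^sub>i\<close>, the remainder of a countable union having small measure. For
  an open set, truncate a large multiple of the distance to its complement. Exact equality
  off a small set, rather than closeness in the mean, is what the Borel-Cantelli lemma
  can be applied to later.\<close>

lemma borel_set_approx_continuous:
  fixes M :: "'a::metric_space measure"
  assumes fin: "finite_measure M" and M: "sets M = sets borel" and A: "A \<in> sets borel"
    and e: "0 < e"
  shows "\<exists>g :: 'a \<Rightarrow> real. continuous_on UNIV g \<and> measure M {x. g x \<noteq> indicator A x} < e"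
proof -
  interpret finite_measure M by fact
  have [simp]: "space M = UNIV"
    using sets_eq_imp_space_eq[OF M] by simp
  have [measurable_cong]: "sets M = sets borel" by fact
  have "A \<in> sigma_sets UNIV {S. open S}"
    using A by (simp add: sets_borel)
  then show ?thesis using e
  proof (induction arbitrary: e rule: sigma_sets.induct)
    case (Basic U)
    then have U: "open U" by simp
    show ?case
    proof (cases "U = UNIV")
      case True
      with Basic.prems show ?thesis by (intro exI[of _ "\<lambda>_. 1"]) simp
    next
      case False
      \<comment> \<open>The exceptional set of the truncation of \<open>n\<close> times the distance to the complement.\<close>
      define D where "D n = {x \<in> U. real n * infdist x (- U) < 1}" for n :: nat
      have D: "D n \<in> sets M" for n
      proof -
        have "open D" if "D = U \<inter> (\<lambda>x. real n * infdist x (- U)) -` {..<1}" for D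
          unfolding that by (intro open_Int U open_vimage open_lessThan continuous_intros)
        moreover have "D n = U \<inter> (\<lambda>x. real n * infdist x (- U)) -` {..<1}"
          by (auto simp: D_def)
        ultimately show ?thesis by (simp add: M)
      qed
      have "decseq D"
      proof (intro decseq_SucI subsetI)
        fix n x assume "x \<in> D (Suc n)"
        moreover have "real n * infdist x (- U) \<le> real (Suc n) * infdist x (- U)"
          by (intro mult_right_mono) (auto simp: infdist_nonneg)
        ultimately show "x \<in> D n" by (auto simp: D_def)
      qed
      moreover have "(\<Inter>n. D n) = {}"
      proof (rule ccontr)
        assume "(\<Inter>n. D n) \<noteq> {}"
        then obtain x where x: "\<And>n. x \<in> D n" by auto
        then have "x \<in> U" by (auto simp: D_def)
        then have "0 < infdist x (- U)"
          using U False by (intro infdist_pos_not_in_closed) (auto simp: closed_def)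
        then obtain n where "1 < real n * infdist x (- U)"
          using reals_Archimedean3 by blast
        with x[of n] show False by (simp add: D_def)
      qed
      ultimately have "(\<lambda>n. measure M (D n)) \<longlonglongrightarrow> 0"
        using finite_Lim_measure_decseq[of D] D by (auto simp: image_subset_iff)
      from order_tendstoD(2)[OF this Basic.prems] obtain n where n: "measure M (D n) < e"
        by (auto simp: eventually_sequentially)
      define g where "g x = min 1 (real n * infdist x (- U))" for x
      have "{x. g x \<noteq> indicator U x} \<subseteq> D n"
        by (auto simp: g_def D_def indicator_def min_def split: if_splits)
      then have "measure M {x. g x \<noteq> indicator U x} < e"
        using finite_measure_mono[OF _ D] n by (meson le_less_trans)
      moreover have "continuous_on UNIV g"
        unfolding g_def by (intro continuous_intros)
      ultimately show ?thesis by blast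
    qed
  next
    case Empty
    then show ?case by (intro exI[of _ "\<lambda>_. 0"]) simp
  next
    case (Compl A)
    obtain g :: "'a \<Rightarrow> real" where g: "continuous_on UNIV g" "measure M {x. g x \<noteq> indicator A x} < e"
      using Compl.IH[OF Compl.prems] by blast
    moreover have "{x. 1 - g x \<noteq> indicator (UNIV - A) x} = {x. g x \<noteq> indicator A x}"
      by (auto simp: indicator_def)
    ultimately show ?case
      by (intro exI[of _ "\<lambda>x. 1 - g x"]) (auto intro!: continuous_intros)
  next
    case (Union A)
    have A: "A i \<in> sets M" for i
      using Union.hyps by (simp add: M sets_borel)
    let ?U = "\<Union>i. A i"
    define D where "D n = ?U - (\<Union>i<n. A i)" for n
    have D: "D n \<in> sets M" for n
      unfolding D_def using A by auto
    have "decseq D"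
      by (intro decseq_SucI) (auto simp: D_def less_Suc_eq)
    moreover have "(\<Inter>n. D n) = {}"
      by (auto simp: D_def)
    ultimately have "(\<lambda>n. measure M (D n)) \<longlonglongrightarrow> 0"
      using finite_Lim_measure_decseq[of D] D by (auto simp: image_subset_iff)
    from order_tendstoD(2)[OF this, of "e / 2"] Union.prems
    obtain n where n: "measure M (D n) < e / 2"
      by (auto simp: eventually_sequentially)
    \<comment> \<open>Half of \<open>e\<close> pays for the remainder, the other half is shared among the first \<open>n\<close> sets.\<close>
    define d where "d = e / (2 * (real n + 1))"
    have "0 < d" using Union.prems by (simp add: d_def)
    then have "\<forall>i. \<exists>g :: 'a \<Rightarrow> real. continuous_on UNIV g \<and> measure M {x. g x \<noteq> indicator (A i) x} < d"
      using Union.IH by blast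
    then obtain g :: "nat \<Rightarrow> 'a \<Rightarrow> real"
      where g: "\<And>i. continuous_on UNIV (g i)" "\<And>i. measure M {x. g i x \<noteq> indicator (A i) x} < d"
      by metis
    define h where "h x = 1 - (\<Prod>i<n. 1 - g i x)" for x
    let ?B = "\<lambda>i. {x. g i x \<noteq> indicator (A i) x}"
    have B: "?B i \<in> sets M" for i
    proof -
      have [measurable]: "g i \<in> borel_measurable borel" "A i \<in> sets borel"
        using borel_measurable_continuous_onI[OF g(1)] A M by auto
      have "{x \<in> space M. g i x \<noteq> indicator (A i) x} \<in> sets M" by measurable
      then show ?thesis by simp
    qed
    have "{x. h x \<noteq> indicator ?U x} \<subseteq> (\<Union>i<n. ?B i) \<union> D n"
    proof (intro subsetI, rule ccontr)
      fix x assume x: "x \<in> {x. h x \<noteq> indicator ?U x}" and "x \<notin> (\<Union>i<n. ?B i) \<union> D n"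
      then have gi: "\<And>i. i < n \<Longrightarrow> g i x = indicator (A i) x"
        and iff: "x \<in> ?U \<longleftrightarrow> (\<exists>i<n. x \<in> A i)"
        by (auto simp: D_def)
      have "h x = 1 - (\<Prod>i<n. 1 - indicator (A i) x)"
        unfolding h_def using gi by simp
      also have "\<dots> = indicator ?U x"
        using iff by (cases "x \<in> ?U") (auto simp: indicator_def prod_zero_iff)
      finally show False using x by simp
    qed
    then have "measure M {x. h x \<noteq> indicator ?U x} \<le> measure M ((\<Union>i<n. ?B i) \<union> D n)"
      using B D by (intro finite_measure_mono) auto
    also have "\<dots> \<le> measure M (\<Union>i<n. ?B i) + measure M (D n)"
      using B D by (intro measure_Un_le) auto
    also have "measure M (\<Union>i<n. ?B i) \<le> (\<Sum>i<n. measure M (?B i))"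
      using B by (intro finite_measure_subadditive_finite) auto
    also have "\<dots> \<le> (\<Sum>i<n. d)"
      using g(2) by (intro sum_mono) (simp add: less_imp_le)
    also have "\<dots> \<le> e / 2"
      using Union.prems by (simp add: d_def field_simps)
    finally have "measure M {x. h x \<noteq> indicator ?U x} < e"
      using n by simp
    moreover have "continuous_on UNIV h"
      unfolding h_def by (intro continuous_intros g)
    ultimately show ?case by blast
  qed
qed

section \<open>Streamwise contraction and saturated representatives\<close>

text \<open>Points outside the support of \<open>T\<close> are left unconstrained, so that a saturated set can be obtained
  from a condition on orbits that makes sense everywhere.\<close>

definition saturated :: "'a turbulation \<Rightarrow> 'a set \<Rightarrow> bool" where
  "saturated T P \<longleftrightarrow> (\<forall>(X, \<nu>)\<in>T. \<forall>x\<in>topspace X. \<forall>y\<in>topspace X. x \<in> P \<longrightarrow> y \<in> P)"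

lemma saturated_subset:
  assumes "saturated T P" "(X, \<nu>) \<in> T" "x \<in> topspace X" "x \<in> P"
  shows "topspace X \<subseteq> P"
  using assms unfolding saturated_def by fast

lemma saturated_Compl: "saturated T P \<Longrightarrow> saturated T (- P)"
  unfolding saturated_def by fast

text \<open>The condition speaks only of the end points and the measure of an arc. This is what tameness
  takes as input, and it treats \<open>F\<close> on stable and the inverse of \<open>F\<close> on unstable streamlines alike.\<close>

definition streamwise_contraction :: "'a::metric_space turbulation \<Rightarrow> ('a \<Rightarrow> 'a) \<Rightarrow> real \<Rightarrow> bool" where
  "streamwise_contraction T G c \<longleftrightarrow>
     (\<forall>(X, \<nu>)\<in>T. \<exists>(Y, \<nu>')\<in>T. \<forall>x y A. closed_arc X x y A \<longrightarrow>
        closed_arc Y (G x) (G y) (G ` A) \<and> ennreal c * emeasure \<nu>' (G ` A) = emeasure \<nu> A)"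

lemma streamwise_contraction_funpow:
  assumes "streamwise_contraction T G c" and "1 < c"
  shows "streamwise_contraction T (G ^^ n) (c ^ n)"
proof (induction n)
  case 0
  then show ?case by (auto simp: streamwise_contraction_def)
next
  case (Suc n)
  show ?case unfolding streamwise_contraction_def
  proof safe
    fix X \<nu> assume "(X, \<nu>) \<in> T"
    with Suc obtain Y \<nu>' where Y: "(Y, \<nu>') \<in> T"
      and XY: "\<And>x y A. closed_arc X x y A \<Longrightarrow> closed_arc Y ((G ^^ n) x) ((G ^^ n) y) ((G ^^ n) ` A)
        \<and> ennreal (c ^ n) * emeasure \<nu>' ((G ^^ n) ` A) = emeasure \<nu> A"
      unfolding streamwise_contraction_def by blast
    from Y assms obtain Z \<nu>'' where Z: "(Z, \<nu>'') \<in> T"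
      and YZ: "\<And>x y A. closed_arc Y x y A \<Longrightarrow> closed_arc Z (G x) (G y) (G ` A)
        \<and> ennreal c * emeasure \<nu>'' (G ` A) = emeasure \<nu>' A"
      unfolding streamwise_contraction_def by blast
    have c: "ennreal (c ^ Suc n) = ennreal (c ^ n) * ennreal c"
      using \<open>1 < c\<close> by (simp add: ennreal_mult' mult.commute)
    have "closed_arc Z ((G ^^ Suc n) x) ((G ^^ Suc n) y) ((G ^^ Suc n) ` A)
      \<and> ennreal (c ^ Suc n) * emeasure \<nu>'' ((G ^^ Suc n) ` A) = emeasure \<nu> A"
      if "closed_arc X x y A" for x y A
      using YZ[OF conjunct1[OF XY[OF that]]] XY[OF that]
      unfolding c by (simp add: image_comp mult.assoc)
    with Z show "\<exists>(Y, \<nu>')\<in>T. \<forall>x y A. closed_arc X x y A \<longrightarrow>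
        closed_arc Y ((G ^^ Suc n) x) ((G ^^ Suc n) y) ((G ^^ Suc n) ` A) \<and>
        ennreal (c ^ Suc n) * emeasure \<nu>' ((G ^^ Suc n) ` A) = emeasure \<nu> A"
      by blast
  qed
qed

text \<open>The exponent is chosen such that arcs of measure at most \<open>r\<close> have images of measure
  below the \<open>\<delta>\<close> that tameness assigns to \<open>\<epsilon>\<close>.\<close>

lemma tame_contraction_uniform:
  assumes T: "tame T" and G: "streamwise_contraction T G c" and c: "1 < c" and \<epsilon>: "0 < \<epsilon>"
  shows "\<exists>n. \<forall>(X, \<nu>)\<in>T. \<forall>x y A. closed_arc X x y A \<and> emeasure \<nu> A \<le> ennreal r \<longrightarrow>
           dist ((G ^^ n) x) ((G ^^ n) y) < \<epsilon>"
proof -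
  from T[unfolded tame_def, rule_format, OF \<epsilon>] obtain \<delta> where \<delta>: "0 < \<delta>" and
    "\<forall>(X, \<nu>)\<in>T. \<forall>x y A. closed_arc X x y A \<and> emeasure \<nu> A < ennreal \<delta> \<longrightarrow> dist x y < \<epsilon>"
    by (elim exE conjE)
  then have tame: "dist x y < \<epsilon>"
    if "(X, \<nu>) \<in> T" "closed_arc X x y A" "emeasure \<nu> A < ennreal \<delta>" for X \<nu> x y A
    using that by fast
  obtain n where n: "r / \<delta> < c ^ n"
    using real_arch_pow[OF c] by blast
  have cn: "0 < c ^ n" using c by simp
  have "dist ((G ^^ n) x) ((G ^^ n) y) < \<epsilon>"
    if X: "(X, \<nu>) \<in> T" and A: "closed_arc X x y A" "emeasure \<nu> A \<le> ennreal r" for X \<nu> x y A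
  proof -
    obtain Y \<nu>' where Y: "(Y, \<nu>') \<in> T" "closed_arc Y ((G ^^ n) x) ((G ^^ n) y) ((G ^^ n) ` A)"
      "ennreal (c ^ n) * emeasure \<nu>' ((G ^^ n) ` A) = emeasure \<nu> A"
      using streamwise_contraction_funpow[OF G c, of n] X A(1)
      unfolding streamwise_contraction_def by blast
    have "emeasure \<nu>' ((G ^^ n) ` A) < ennreal \<delta>"
    proof (rule ccontr)
      assume "\<not> ?thesis"
      then have "ennreal (c ^ n) * ennreal \<delta> \<le> emeasure \<nu> A"
        unfolding Y(3)[symmetric] by (intro mult_left_mono) auto
      then have "ennreal (c ^ n * \<delta>) \<le> ennreal r"
        using A(2) cn \<delta> by (simp add: ennreal_mult)
      moreover have "r < c ^ n * \<delta>" "0 < c ^ n * \<delta>"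
        using n \<delta> cn by (simp_all add: field_simps)
      ultimately show False
        by (simp add: ennreal_le_iff2)
    qed
    from tame[OF Y(1,2) this] show ?thesis .
  qed
  then show ?thesis by blast
qed

lemma closed_arc_in_streamline:
  assumes X: "immersed_line X" and xy: "x \<in> topspace X" "y \<in> topspace X" "x \<noteq> y"
  obtains A where "closed_arc X x y A \<or> closed_arc X y x A"
proof -
  obtain \<phi> where \<phi>: "line_param X \<phi>"
    using X by (auto simp: immersed_line_def)
  then have "\<phi> ` UNIV = topspace X"
    by (auto simp: line_param_def homeomorphic_eq_everything_map)
  then obtain a b where ab: "x = \<phi> a" "y = \<phi> b"
    using xy by blast
  then consider "a < b" | "b < a" using xy(3) by fastforce
  then show thesis
    using \<phi> ab that unfolding closed_arc_def by cases blast+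
qed

text \<open>The representative is the set of points where \<open>g\<^sub>k \<circ> G ^^ N\<^sub>k\<close> tends to 1. Invariance of \<open>A\<close> makes the
  set where this function differs from the indicator of \<open>A\<close> a preimage of the set where \<open>g\<^sub>k\<close> does, so
  its measure stays summable for every choice of \<open>N\<^sub>k\<close>. This leaves \<open>N\<^sub>k\<close> free to be taken so large that
  the limit cannot tell apart two points of the same streamline: the arc between them has finite
  measure, hence measure at most \<open>k\<close> for all large \<open>k\<close>.\<close>

lemma saturated_representative:
  fixes \<mu> :: "'a::metric_space measure"
  assumes cpt: "compact (UNIV :: 'a set)" and \<mu>: "sets \<mu> = sets borel" and fin: "finite_measure \<mu>"
    and T: "\<And>X \<nu>. (X, \<nu>) \<in> T \<Longrightarrow> immersed_line X \<and> stream_measure X \<nu>" and tame: "tame T"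
    and G: "streamwise_contraction T G c" and c: "1 < c" and mp: "measure_preserving \<mu> G"
    and A: "A \<in> sets \<mu>" and inv: "G -` A = A"
  shows "\<exists>P\<in>sets \<mu>. saturated T P \<and> (AE x in \<mu>. x \<in> P \<longleftrightarrow> x \<in> A)"
proof -
  interpret finite_measure \<mu> by fact
  have sp[simp]: "space \<mu> = UNIV"
    using sets_eq_imp_space_eq[OF \<mu>] by simp
  have [measurable_cong]: "sets \<mu> = sets borel" by fact
  have [measurable]: "G \<in> measurable \<mu> \<mu>" and pres: "distr \<mu> \<mu> G = \<mu>"
    using mp by (auto simp: measure_preserving_def)
  have Gn[measurable]: "(G ^^ n) \<in> measurable \<mu> \<mu>" for n
    by (induction n) (auto intro: measurable_comp)
  have presn: "distr \<mu> \<mu> (G ^^ n) = \<mu>" for n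
  proof (induction n)
    case (Suc n)
    have "distr \<mu> \<mu> (G ^^ Suc n) = distr (distr \<mu> \<mu> (G ^^ n)) \<mu> G"
      by (simp add: distr_distr)
    then show ?case using Suc pres by (simp add: o_def)
  qed (simp add: id_def distr_id)
  have invn: "(G ^^ n) x \<in> A \<longleftrightarrow> x \<in> A" for n x
  proof (induction n)
    case (Suc n)
    have "G z \<in> A \<longleftrightarrow> z \<in> A" for z
      using inv by blast
    with Suc show ?case by simp
  qed simp

  have "\<forall>k. \<exists>g :: 'a \<Rightarrow> real. continuous_on UNIV g \<and> measure \<mu> {x. g x \<noteq> indicator A x} < (1/2) ^ k"
    using borel_set_approx_continuous[OF fin \<mu>] A \<mu> by simp
  then obtain g :: "nat \<Rightarrow> 'a \<Rightarrow> real" where g: "\<And>k. continuous_on UNIV (g k)"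
    "\<And>k. measure \<mu> {x. g k x \<noteq> indicator A x} < (1/2) ^ k"
    by metis
  have [measurable]: "g k \<in> borel_measurable \<mu>" for k
    using borel_measurable_continuous_onI[OF g(1)] by (simp add: measurable_cong_sets[OF \<mu> refl])
  have "\<exists>d>0. \<forall>x y. dist x y < d \<longrightarrow> dist (g k x) (g k y) < inverse (real (Suc k))" for k
    using compact_uniformly_continuous[OF g(1) cpt] unfolding uniformly_continuous_on_def
    by (metis UNIV_I dist_commute inverse_positive_iff_positive of_nat_0_less_iff zero_less_Suc)
  then obtain d where d: "\<And>k. 0 < d k"
    "\<And>k x y. dist x y < d k \<Longrightarrow> dist (g k x) (g k y) < inverse (real (Suc k))"
    by metis
  obtain N where N: "\<And>k X \<nu> x y A. (X, \<nu>) \<in> T \<Longrightarrow> closed_arc X x y A \<Longrightarrow>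
      emeasure \<nu> A \<le> ennreal (real k) \<Longrightarrow> dist ((G ^^ N k) x) ((G ^^ N k) y) < d k"
  proof -
    have "\<forall>k. \<exists>n. \<forall>X \<nu> x y A. (X, \<nu>) \<in> T \<and> closed_arc X x y A \<and> emeasure \<nu> A \<le> ennreal (real k) \<longrightarrow>
        dist ((G ^^ n) x) ((G ^^ n) y) < d k"
      using tame_contraction_uniform[OF tame G c d(1)] by fast
    from choice[OF this] show thesis
      using that by blast
  qed
  define f where "f k x = g k ((G ^^ N k) x)" for k x
  have [measurable]: "f k \<in> borel_measurable \<mu>" for k
    unfolding f_def by measurable
  define P where "P = {x. (\<lambda>k. f k x) \<longlonglongrightarrow> 1}"
  \<comment> \<open>A description of convergence by countably many conditions, for measurability.\<close>
  have "P = {x \<in> space \<mu>. \<forall>j. \<exists>m. \<forall>k\<ge>m. dist (f k x) 1 < inverse (real (Suc j))}"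
  proof (intro set_eqI iffI)
    fix x assume "x \<in> P"
    then have "\<exists>m. \<forall>k\<ge>m. dist (f k x) 1 < inverse (real (Suc j))" for j
      unfolding P_def mem_Collect_eq lim_sequentially by (simp del: of_nat_Suc)
    then show "x \<in> {x \<in> space \<mu>. \<forall>j. \<exists>m. \<forall>k\<ge>m. dist (f k x) 1 < inverse (real (Suc j))}"
      by simp
  next
    fix x assume x: "x \<in> {x \<in> space \<mu>. \<forall>j. \<exists>m. \<forall>k\<ge>m. dist (f k x) 1 < inverse (real (Suc j))}"
    show "x \<in> P"
      unfolding P_def mem_Collect_eq
    proof (rule metric_LIMSEQ_I)
      fix r :: real assume "0 < r"
      then obtain j where j: "inverse (real (Suc j)) < r"
        using reals_Archimedean by blast
      from x obtain m where "\<forall>k\<ge>m. dist (f k x) 1 < inverse (real (Suc j))"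
        by blast
      with j show "\<exists>m. \<forall>k\<ge>m. dist (f k x) 1 < r"
        by (meson less_trans)
    qed
  qed
  also have "\<dots> \<in> sets \<mu>" by measurable
  finally have P: "P \<in> sets \<mu>" .

  have one_way: "y \<in> P" if "x \<in> P" and X: "(X, \<nu>) \<in> T" and xy: "x \<in> topspace X" "y \<in> topspace X" for X \<nu> x y
  proof (cases "x = y")
    case False
    then obtain B where B: "closed_arc X x y B \<or> closed_arc X y x B"
      using closed_arc_in_streamline T[OF X] xy by metis
    then have "emeasure \<nu> B < \<infinity>"
      using T[OF X] unfolding stream_measure_def by blast
    then obtain K :: nat where K: "emeasure \<nu> B \<le> ennreal (real K)"
      by (metis ennreal_of_nat_eq_real_of_nat ennreal_Ex_less_of_nat less_imp_le infinity_ennreal_def)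
    have close: "dist (f k y) (f k x) < inverse (real (Suc k))" if "K \<le> k" for k
    proof -
      have "emeasure \<nu> B \<le> ennreal (real k)"
        using K that by (meson ennreal_leI of_nat_le_iff order_trans)
      then have "dist ((G ^^ N k) y) ((G ^^ N k) x) < d k"
        using B N[OF X] by (metis dist_commute)
      from d(2)[OF this] show ?thesis by (simp add: f_def)
    qed
    have "(\<lambda>k. f k y - f k x) \<longlonglongrightarrow> 0"
    proof (rule Lim_null_comparison[OF _ LIMSEQ_inverse_real_of_nat])
      show "\<forall>\<^sub>F k in sequentially. norm (f k y - f k x) \<le> inverse (real (Suc k))"
        using close unfolding eventually_sequentially by (metis dist_norm less_imp_le)
    qed
    from tendsto_add[OF this] \<open>x \<in> P\<close> show ?thesis
      by (fastforce simp: P_def)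
  qed (use that in simp)
  then have sat: "saturated T P"
    unfolding saturated_def by blast

  \<comment> \<open>The exceptional sets have summable measures, whatever the choice of \<open>N\<close>.\<close>
  let ?D = "\<lambda>k. {x. f k x \<noteq> indicator A x}"
  have D_eq: "?D k = (G ^^ N k) -` {x. g k x \<noteq> indicator A x} \<inter> space \<mu>" for k
    using invn by (auto simp: f_def indicator_def)
  have gD: "{x. g k x \<noteq> indicator A x} \<in> sets \<mu>" for k
  proof -
    have [measurable]: "A \<in> sets \<mu>" by fact
    have "{x \<in> space \<mu>. g k x \<noteq> indicator A x} \<in> sets \<mu>" by measurable
    then show ?thesis by simp
  qed
  have D: "?D k \<in> sets \<mu>" for k
    unfolding D_eq by (rule measurable_sets[OF Gn gD])
  have mD: "measure \<mu> (?D k) < (1/2) ^ k" for k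
  proof -
    have "measure \<mu> (?D k) = measure (distr \<mu> \<mu> (G ^^ N k)) {x. g k x \<noteq> indicator A x}"
      unfolding D_eq by (rule measure_distr[OF Gn gD, symmetric])
    then show ?thesis using g(2)[of k] by (simp add: presn)
  qed
  have "summable (\<lambda>k. measure \<mu> (?D k))"
    by (rule summable_comparison_test'[of "\<lambda>k. (1/2::real) ^ k" 0])
      (use mD in \<open>auto intro: summable_geometric less_imp_le\<close>)
  from borel_cantelli_AE1[OF D _ this]
  have "AE x in \<mu>. eventually (\<lambda>k. x \<in> space \<mu> - ?D k) sequentially"
    by (simp add: emeasure_eq_measure)
  then have "AE x in \<mu>. x \<in> P \<longleftrightarrow> x \<in> A"
  proof eventually_elim
    case (elim x)
    then have "eventually (\<lambda>k. f k x = indicator A x) sequentially"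
      by simp
    then have lim: "(\<lambda>k. f k x) \<longlonglongrightarrow> indicator A x"
      by (rule tendsto_eventually)
    show ?case
    proof
      assume "x \<in> P"
      with lim have "indicator A x = (1::real)"
        unfolding P_def using LIMSEQ_unique by blast
      then show "x \<in> A" by (simp add: indicator_eq_1_iff)
    next
      assume "x \<in> A"
      with lim show "x \<in> P" by (simp add: P_def)
    qed
  qed
  with P sat show ?thesis by blast
qed

section \<open>Borel sets of a streamline\<close>

lemma space_borel_on [simp]: "space (borel_on X) = topspace X"
  unfolding borel_on_def by (intro space_measure_of) (auto dest: openin_subset)

lemma sets_borel_on: "sets (borel_on X) = sigma_sets (topspace X) {U. openin X U}"
  unfolding borel_on_def by (intro sets_measure_of) (auto dest: openin_subset)

lemma borel_on_euclidean: "sets (borel_on euclidean) = sets borel"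
  by (simp add: sets_borel_on sets_borel)

lemma continuous_map_measurable_borel_on:
  assumes "continuous_map X Y f"
  shows "f \<in> measurable (borel_on X) (borel_on Y)"
  unfolding borel_on_def[of Y]
proof (rule measurable_measure_of)
  show "{U. openin Y U} \<subseteq> Pow (topspace Y)"
    by (auto dest: openin_subset)
  show "f \<in> space (borel_on X) \<rightarrow> topspace Y"
    using assms by (auto simp: continuous_map_def)
  fix U assume "U \<in> {U. openin Y U}"
  then have "openin X {x \<in> topspace X. f x \<in> U}"
    using assms by (auto simp: continuous_map_def)
  moreover have "{x \<in> topspace X. f x \<in> U} = f -` U \<inter> space (borel_on X)"
    by auto
  ultimately show "f -` U \<inter> space (borel_on X) \<in> sets (borel_on X)"
    by (auto simp: sets_borel_on)
qed

lemma homeomorphic_map_image_borel_on: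
  assumes f: "homeomorphic_map X Y f" and A: "A \<in> sets (borel_on X)"
  shows "f ` A \<in> sets (borel_on Y)"
proof -
  obtain g where g: "homeomorphic_maps X Y f g"
    using f by (auto simp: homeomorphic_map_maps)
  have maps: "\<And>x. x \<in> topspace X \<Longrightarrow> f x \<in> topspace Y" "\<And>x. x \<in> topspace X \<Longrightarrow> g (f x) = x"
    "\<And>y. y \<in> topspace Y \<Longrightarrow> f (g y) = y"
    using g by (auto simp: homeomorphic_maps_def continuous_map_def)
  have "A \<subseteq> topspace X"
    using sets.sets_into_space[OF A] by simp
  then have "f ` A = g -` A \<inter> space (borel_on Y)"
    using maps by (auto simp: subset_iff image_iff) metis
  also have "\<dots> \<in> sets (borel_on Y)"
    using g A by (intro measurable_sets[OF continuous_map_measurable_borel_on])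
      (auto simp: homeomorphic_maps_def)
  finally show ?thesis .
qed

lemma line_param_image_borel:
  assumes "line_param X \<phi>" and "S \<in> sets borel"
  shows "\<phi> ` S \<in> sets (borel_on X)"
  using assms homeomorphic_map_image_borel_on[of euclideanreal X \<phi> S]
  by (simp add: line_param_def borel_on_euclidean)

text \<open>The line topology is finer than the subspace topology, so it has at least as many Borel sets.\<close>

lemma borel_Int_streamline:
  assumes X: "immersed_line X" and P: "P \<in> sets borel"
  shows "P \<inter> topspace X \<in> sets (borel_on X)"
proof -
  obtain \<phi> where \<phi>: "line_param X \<phi>"
    using X by (auto simp: immersed_line_def)
  have "\<phi> -` P \<inter> space borel \<in> sets borel"
    using \<phi> P by (intro measurable_sets[OF borel_measurable_continuous_onI]) (auto simp: line_param_def)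
  then have "\<phi> ` (\<phi> -` P) \<in> sets (borel_on X)"
    by (intro line_param_image_borel[OF \<phi>]) simp
  moreover have "\<phi> ` (\<phi> -` P) = P \<inter> topspace X"
  proof -
    have "range \<phi> = topspace X"
      using \<phi> by (auto simp: line_param_def homeomorphic_eq_everything_map)
    then show ?thesis by auto
  qed
  ultimately show ?thesis by simp
qed

text \<open>Arcs are images of intervals, open, closed or half-open, under a homeomorphism.\<close>

lemma stream_arc_properties:
  assumes "stream_arc X A"
  shows "A \<noteq> {}" "A \<subseteq> topspace X" "A \<in> sets (borel_on X)"
proof -
  obtain \<phi> :: "real \<Rightarrow> 'a" and a b where \<phi>: "line_param X \<phi>" and ab: "a < b"
    and A: "A \<in> {\<phi> ` {a..b}, \<phi> ` {a<..<b}, \<phi> ` {a..<b}, \<phi> ` {a<..b}}"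
    using assms by (auto simp: stream_arc_def arc_between_def)
  then obtain S where S: "A = \<phi> ` S" "S \<in> {{a..b}, {a<..<b}, {a..<b}, {a<..b}}"
    by blast
  then have "S \<in> sets borel" "S \<noteq> {}"
    using ab by auto
  with S(1) line_param_image_borel[OF \<phi>] show "A \<noteq> {}" "A \<in> sets (borel_on X)"
    by auto
  then show "A \<subseteq> topspace X"
    using sets.sets_into_space by fastforce
qed

lemma closed_arc_borel: "closed_arc X x y A \<Longrightarrow> A \<in> sets (borel_on X)"
  by (auto simp: closed_arc_def intro: line_param_image_borel)

section \<open>Contraction of streamlines by a map preserving the turbulation, or by its inverse\<close>

lemma homeomorphic_maps_image_line:
  assumes "bij F"
  shows "homeomorphic_maps X (image_line F X) F (inv F)"
proof -
  have F: "inv F (F x) = x" "F (inv F x) = x" for x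
    using assms by (simp_all add: bij_is_inj bij_is_surj surj_f_inv_f)
  have "continuous_map X (image_line F X) F"
    unfolding continuous_map_def
  proof (intro conjI allI impI)
    show "F \<in> topspace X \<rightarrow> topspace (image_line F X)"
      by (auto simp: image_line_def topspace_pullback_topology F)
    fix V assume "openin (image_line F X) V"
    then obtain U where U: "openin X U" "V = inv F -` U"
      by (auto simp: image_line_def openin_pullback_topology)
    then have "{x \<in> topspace X. F x \<in> V} = U"
      using openin_subset[OF U(1)] by (auto simp: F)
    with U show "openin X {x \<in> topspace X. F x \<in> V}" by simp
  qed
  moreover have "continuous_map (image_line F X) X (inv F)"
    unfolding image_line_def using continuous_map_pullback[OF continuous_map_id, of UNIV "inv F" X]
    by (simp add: id_def comp_def)
  ultimately show ?thesis
    by (auto simp: homeomorphic_maps_def F)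
qed

lemma homeomorphic_map_image_line: "bij F \<Longrightarrow> homeomorphic_map X (image_line F X) F"
  using homeomorphic_maps_image_line by (auto simp: homeomorphic_map_maps)

lemma closed_arc_image:
  assumes "continuous_on UNIV G" "homeomorphic_map X Y G" "closed_arc X x y A"
  shows "closed_arc Y (G x) (G y) (G ` A)"
proof -
  obtain \<phi> a b where \<phi>: "line_param X \<phi>" and ab: "a < b" "\<phi> a = x" "\<phi> b = y" "A = \<phi> ` {a..b}"
    using assms(3) by (auto simp: closed_arc_def)
  have "line_param Y (G \<circ> \<phi>)"
    using \<phi> assms(1,2) unfolding line_param_def
    by (meson continuous_on_compose continuous_on_subset homeomorphic_map_compose subset_UNIV)
  moreover have "G ` A = (G \<circ> \<phi>) ` {a..b}" "(G \<circ> \<phi>) a = G x" "(G \<circ> \<phi>) b = G y"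
    using ab by (auto simp: image_comp)
  ultimately show ?thesis
    unfolding closed_arc_def using ab(1) by blast
qed

lemma emeasure_streamline_image:
  assumes F: "bij F" and \<nu>: "sets \<nu> = sets (borel_on X)" and A: "A \<in> sets (borel_on X)"
  shows "emeasure (distr \<nu> (borel_on (image_line F X)) F) (F ` A) = emeasure \<nu> A"
proof -
  let ?Y = "image_line F X"
  have sp: "space \<nu> = topspace X"
    using sets_eq_imp_space_eq[OF \<nu>] by simp
  have hom: "homeomorphic_map X ?Y F"
    by (rule homeomorphic_map_image_line[OF F])
  then have "F \<in> measurable (borel_on X) (borel_on ?Y)"
    by (intro continuous_map_measurable_borel_on homeomorphic_imp_continuous_map)
  then have "F \<in> measurable \<nu> (borel_on ?Y)"
    by (simp add: measurable_cong_sets[OF \<nu> refl])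
  note emeasure_distr[OF this homeomorphic_map_image_borel_on[OF hom A]]
  moreover have "F -` (F ` A) \<inter> space \<nu> = A"
    using sets.sets_into_space[OF A] by (auto simp: sp inj_vimage_image_eq[OF bij_is_inj[OF F]])
  ultimately show ?thesis by simp
qed

text \<open>The stream measure on the image line, multiplied by \<open>c\<close>, is the push-forward under \<open>F\<close> of the one
  on \<open>X\<close>; evaluate both on the image of an arc.\<close>

lemma streamwise_contraction_forward:
  assumes F: "bij F" "continuous_on UNIV F"
    and T: "\<And>X \<nu>. (X, \<nu>) \<in> T \<Longrightarrow> sets \<nu> = sets (borel_on X)"
    and inv: "image_turbulation F T = scale_turbulation c T"
  shows "streamwise_contraction T F c"
  unfolding streamwise_contraction_def
proof safe
  fix X \<nu> assume X: "(X, \<nu>) \<in> T"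
  let ?Y = "image_line F X"
  have "(?Y, distr \<nu> (borel_on ?Y) F) \<in> scale_turbulation c T"
    using X unfolding inv[symmetric] image_turbulation_def by force
  then obtain \<nu>' where \<nu>': "(?Y, \<nu>') \<in> T" "distr \<nu> (borel_on ?Y) F = scale_measure (ennreal c) \<nu>'"
    by (auto simp: scale_turbulation_def)
  have "closed_arc ?Y (F x) (F y) (F ` A) \<and> ennreal c * emeasure \<nu>' (F ` A) = emeasure \<nu> A"
    if A: "closed_arc X x y A" for x y A
    using closed_arc_image[OF F(2) homeomorphic_map_image_line[OF F(1)] A]
      emeasure_streamline_image[OF F(1) T[OF X] closed_arc_borel[OF A]]
    by (simp add: \<nu>'(2))
  with \<nu>'(1) show "\<exists>(Y, \<nu>')\<in>T. \<forall>x y A. closed_arc X x y A \<longrightarrow>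
      closed_arc Y (F x) (F y) (F ` A) \<and> ennreal c * emeasure \<nu>' (F ` A) = emeasure \<nu> A"
    by blast
qed

text \<open>Every streamline of \<open>T\<close> is the image of a streamline of \<open>T\<close>, since scaling the measures does
  not change the lines. The inverse of \<open>F\<close> leads back to that one, undoing an expansion by \<open>c\<close>.\<close>

lemma streamwise_contraction_backward:
  assumes F: "bij F" "continuous_on UNIV (inv F)" and c: "0 < c"
    and T: "\<And>X \<nu>. (X, \<nu>) \<in> T \<Longrightarrow> sets \<nu> = sets (borel_on X)"
    and inv: "image_turbulation F T = scale_turbulation (inverse c) T"
  shows "streamwise_contraction T (inv F) c"
  unfolding streamwise_contraction_def
proof safe
  fix Y \<nu>' assume Y: "(Y, \<nu>') \<in> T"
  have "(Y, scale_measure (ennreal (inverse c)) \<nu>') \<in> image_turbulation F T"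
    using Y unfolding inv scale_turbulation_def by force
  then obtain X \<nu> where X: "(X, \<nu>) \<in> T" and YX: "Y = image_line F X"
    and \<nu>: "scale_measure (ennreal (inverse c)) \<nu>' = distr \<nu> (borel_on Y) F"
    by (auto simp: image_turbulation_def)
  have F_inv: "F ` inv F ` A = A" for A
    using F(1) by (simp add: bij_is_surj image_f_inv_f)
  have "homeomorphic_maps X Y F (inv F)"
    unfolding YX by (rule homeomorphic_maps_image_line[OF F(1)])
  then have hom: "homeomorphic_map Y X (inv F)"
    by (meson homeomorphic_maps_sym homeomorphic_map_maps)
  have "closed_arc X (inv F x) (inv F y) (inv F ` A) \<and> ennreal c * emeasure \<nu> (inv F ` A) = emeasure \<nu>' A"
    if A: "closed_arc Y x y A" for x y A
  proof
    show arc: "closed_arc X (inv F x) (inv F y) (inv F ` A)"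
      by (rule closed_arc_image[OF F(2) hom A])
    have "emeasure \<nu> (inv F ` A) = ennreal (inverse c) * emeasure \<nu>' A"
      using emeasure_streamline_image[OF F(1) T[OF X] closed_arc_borel[OF arc]]
      unfolding YX[symmetric] \<nu>[symmetric] F_inv by simp
    then show "ennreal c * emeasure \<nu> (inv F ` A) = emeasure \<nu>' A"
      using c by (simp add: mult.assoc[symmetric] ennreal_mult'[symmetric])
  qed
  with X show "\<exists>(X, \<nu>)\<in>T. \<forall>x y A. closed_arc Y x y A \<longrightarrow>
      closed_arc X (inv F x) (inv F y) (inv F ` A) \<and> ennreal c * emeasure \<nu> (inv F ` A) = emeasure \<nu>' A"
    by blast
qed

section \<open>Restricting product charts\<close>

lemma sets_pair_restrict_space:
  assumes A: "A \<inter> space M \<in> sets M" and B: "B \<inter> space N \<in> sets N"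
    and X: "X \<in> sets (restrict_space M A \<Otimes>\<^sub>M restrict_space N B)"
  shows "X \<in> sets (M \<Otimes>\<^sub>M N)"
proof -
  let ?E = "(A \<inter> space M) \<times> (B \<inter> space N)"
  let ?R = "restrict_space (M \<Otimes>\<^sub>M N) ?E"
  have E: "?E \<in> sets (M \<Otimes>\<^sub>M N)"
    using A B by (rule pair_measureI)
  have spR: "space ?R = ?E"
    using E by simp
  have f: "fst \<in> measurable ?R (restrict_space M A)"
    by (rule measurable_restrict_space2)
      (auto simp: space_restrict_space space_pair_measure intro: measurable_restrict_space1)
  have s: "snd \<in> measurable ?R (restrict_space N B)"
    by (rule measurable_restrict_space2)
      (auto simp: space_restrict_space space_pair_measure intro: measurable_restrict_space1)
  have "(\<lambda>z. z) \<in> measurable ?R (restrict_space M A \<Otimes>\<^sub>M restrict_space N B)"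
    using measurable_Pair[OF f s] by simp
  from measurable_sets[OF this X] have "X \<inter> ?E \<in> sets ?R"
    unfolding spR by simp
  moreover have "X \<subseteq> ?E"
    using sets.sets_into_space[OF X] by (auto simp: space_restrict_space space_pair_measure)
  ultimately show ?thesis
    using E by (auto simp: sets_restrict_space_iff Int_absorb2)
qed

text \<open>Compute both sides by Fubini: the slices of \<open>X\<close> are empty outside \<open>A\<close> and contained in \<open>B\<close>.\<close>

lemma emeasure_pair_restrict_space:
  assumes N: "sigma_finite_measure N"
    and A: "A \<inter> space M \<in> sets M" and B: "B \<inter> space N \<in> sets N"
    and X: "X \<in> sets (restrict_space M A \<Otimes>\<^sub>M restrict_space N B)"
  shows "emeasure (restrict_space M A \<Otimes>\<^sub>M restrict_space N B) X = emeasure (M \<Otimes>\<^sub>M N) X"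
proof -
  interpret N: sigma_finite_measure N by fact
  have "sigma_finite_measure (restrict_space N (B \<inter> space N))"
    by (rule sigma_finite_measure_restrict_space[OF N B])
  moreover have "restrict_space N (B \<inter> space N) = restrict_space N B"
  proof -
    have "(\<inter>) (B \<inter> space N) ` sets N = (\<inter>) B ` sets N"
      by (rule image_cong) (auto dest: sets.sets_into_space)
    then show ?thesis
      by (simp add: restrict_space_def Int_ac)
  qed
  ultimately interpret NB: sigma_finite_measure "restrict_space N B" by simp
  have XMN: "X \<in> sets (M \<Otimes>\<^sub>M N)"
    by (rule sets_pair_restrict_space[OF A B X])
  have Xsub: "X \<subseteq> (A \<inter> space M) \<times> (B \<inter> space N)"
    using sets.sets_into_space[OF X] by (auto simp: space_restrict_space space_pair_measure)
  have "emeasure (restrict_space M A \<Otimes>\<^sub>M restrict_space N B) X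
      = (\<integral>\<^sup>+x. emeasure (restrict_space N B) (Pair x -` X) \<partial>restrict_space M A)"
    by (rule NB.emeasure_pair_measure_alt[OF X])
  also have "\<dots> = (\<integral>\<^sup>+x. emeasure N (Pair x -` X) \<partial>restrict_space M A)"
    using Xsub by (intro nn_integral_cong emeasure_restrict_space[OF B]) auto
  also have "\<dots> = (\<integral>\<^sup>+x. emeasure N (Pair x -` X) * indicator A x \<partial>M)"
    by (rule nn_integral_restrict_space[OF A])
  also have "\<dots> = (\<integral>\<^sup>+x. emeasure N (Pair x -` X) \<partial>M)"
  proof (intro nn_integral_cong)
    fix x
    have "Pair x -` X = {}" if "x \<notin> A"
      using Xsub that by auto
    then show "emeasure N (Pair x -` X) * indicator A x = emeasure N (Pair x -` X)"
      by (cases "x \<in> A") auto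
  qed
  also have "\<dots> = emeasure (M \<Otimes>\<^sub>M N) X"
    by (rule N.emeasure_pair_measure_alt[OF XMN, symmetric])
  finally show ?thesis .
qed

text \<open>The product structure required of compatible tartans, for arbitrary measure spaces.\<close>

definition product_chart ::
    "'a measure \<Rightarrow> 'b measure \<Rightarrow> 'c measure \<Rightarrow> ('a \<times> 'b \<Rightarrow> 'c) \<Rightarrow> bool" where
  "product_chart N1 N2 M \<psi> \<longleftrightarrow>
     bij_betw \<psi> (space N1 \<times> space N2) (space M) \<and>
     \<psi> \<in> measurable (N1 \<Otimes>\<^sub>M N2) M \<and>
     the_inv_into (space N1 \<times> space N2) \<psi> \<in> measurable M (N1 \<Otimes>\<^sub>M N2) \<and>
     distr (N1 \<Otimes>\<^sub>M N2) M \<psi> = M"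

text \<open>By \<open>box\<close>, the part of \<open>M\<close> inside \<open>S\<close> corresponds to a sub-rectangle under the chart. The new chart
  \<open>\<psi>'\<close> is only assumed to agree with \<open>\<psi>\<close> on that sub-rectangle, because the chart of a subtartan may take other
  values elsewhere.\<close>

lemma product_chart_restrict:
  assumes chart: "product_chart N1 N2 M \<psi>" and N2: "sigma_finite_measure N2"
    and S1: "S1 \<inter> space N1 \<in> sets N1" and S2: "S2 \<inter> space N2 \<in> sets N2"
    and S: "S \<inter> space M \<in> sets M"
    and box: "\<And>x y. x \<in> space N1 \<Longrightarrow> y \<in> space N2 \<Longrightarrow> \<psi> (x, y) \<in> S \<longleftrightarrow> x \<in> S1 \<and> y \<in> S2"
    and agree: "\<And>x y. x \<in> S1 \<inter> space N1 \<Longrightarrow> y \<in> S2 \<inter> space N2 \<Longrightarrow> \<psi>' (x, y) = \<psi> (x, y)"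
  shows "product_chart (restrict_space N1 S1) (restrict_space N2 S2) (restrict_space M S) \<psi>'"
proof -
  let ?E = "space N1 \<times> space N2" and ?E' = "(S1 \<inter> space N1) \<times> (S2 \<inter> space N2)"
  let ?P = "N1 \<Otimes>\<^sub>M N2" and ?P' = "restrict_space N1 S1 \<Otimes>\<^sub>M restrict_space N2 S2"
  let ?M' = "restrict_space M S"
  have bij: "bij_betw \<psi> ?E (space M)" and meas: "\<psi> \<in> measurable ?P M"
    and inv: "the_inv_into ?E \<psi> \<in> measurable M ?P" and distr: "distr ?P M \<psi> = M"
    using chart by (auto simp: product_chart_def)
  have sp: "space (restrict_space N1 S1) \<times> space (restrict_space N2 S2) = ?E'"
    "space ?P' = ?E'" "space ?M' = S \<inter> space M"
    by (auto simp: space_restrict_space space_pair_measure)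
  have agree': "\<psi>' z = \<psi> z" if "z \<in> ?E'" for z
    using agree that by (cases z) auto
  have box': "\<psi> z \<in> S \<longleftrightarrow> z \<in> ?E'" if "z \<in> ?E" for z
    using box that by (cases z) auto
  have "\<psi> ` ?E' = S \<inter> space M"
  proof -
    have "\<psi> ` ?E' = S \<inter> \<psi> ` ?E"
      using box' by blast
    then show ?thesis using bij by (simp add: bij_betw_def)
  qed
  moreover have "inj_on \<psi> ?E'"
    by (rule inj_on_subset[OF bij_betw_imp_inj_on[OF bij]]) auto
  ultimately have bij0: "bij_betw \<psi> ?E' (S \<inter> space M)"
    by (simp add: bij_betw_def)
  have bij': "bij_betw \<psi>' ?E' (S \<inter> space M)"
    using bij0 bij_betw_cong[of ?E' \<psi>' \<psi>] agree' by blast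
  have incl: "(\<lambda>z. z) \<in> measurable ?P' ?P"
  proof -
    have "fst \<in> measurable ?P' N1" "snd \<in> measurable ?P' N2"
      using measurable_restrict_space1[of "\<lambda>x. x" N1 N1 S1] measurable_restrict_space1[of "\<lambda>x. x" N2 N2 S2]
      using measurable_compose[OF measurable_fst] measurable_compose[OF measurable_snd] by fastforce+
    from measurable_Pair[OF this] show ?thesis by simp
  qed
  have meas': "\<psi>' \<in> measurable ?P' ?M'"
  proof (rule measurable_restrict_space2)
    show "\<psi>' \<in> space ?P' \<rightarrow> S"
      using bij' unfolding sp by (auto simp: bij_betw_def)
    have "\<psi> \<in> measurable ?P' M"
      using measurable_compose[OF incl meas] by simp
    then show "\<psi>' \<in> measurable ?P' M"
      using measurable_cong[of ?P' \<psi>' \<psi> M] agree' sp by auto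
  qed
  have inv_eq: "the_inv_into ?E' \<psi>' z = the_inv_into ?E \<psi> z" if "z \<in> S \<inter> space M" for z
  proof -
    obtain w where w: "w \<in> ?E'" "z = \<psi> w"
      using bij_betw_imp_surj_on[OF bij0] \<open>z \<in> S \<inter> space M\<close> by blast
    have "the_inv_into ?E \<psi> z = w"
      using w bij by (auto intro!: the_inv_into_f_eq simp: bij_betw_def)
    moreover have "the_inv_into ?E' \<psi>' z = w"
      using w bij' agree' by (auto intro!: the_inv_into_f_eq simp: bij_betw_def)
    ultimately show ?thesis by simp
  qed
  have in_E': "the_inv_into ?E' \<psi>' z \<in> ?E'" if "z \<in> S \<inter> space M" for z
    by (rule bij_betw_apply[OF bij_betw_the_inv_into[OF bij'] that])
  have inv': "the_inv_into ?E' \<psi>' \<in> measurable ?M' ?P'"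
  proof -
    let ?h = "the_inv_into ?E' \<psi>'"
    have "the_inv_into ?E \<psi> \<in> measurable ?M' ?P"
      by (rule measurable_restrict_space1[OF inv])
    then have h: "?h \<in> measurable ?M' ?P"
      using measurable_cong[of ?M' ?h "the_inv_into ?E \<psi>" ?P] inv_eq sp(3) by auto
    have "(fst \<circ> ?h) z \<in> S1" "(snd \<circ> ?h) z \<in> S2" if "z \<in> space ?M'" for z
      using in_E'[of z] that unfolding sp(3) mem_Times_iff by simp_all
    then have "fst \<circ> ?h \<in> space ?M' \<rightarrow> S1" "snd \<circ> ?h \<in> space ?M' \<rightarrow> S2"
      by blast+
    then have "fst \<circ> ?h \<in> measurable ?M' (restrict_space N1 S1)"
      "snd \<circ> ?h \<in> measurable ?M' (restrict_space N2 S2)"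
      using measurable_comp[OF h measurable_fst] measurable_comp[OF h measurable_snd]
      by (auto intro: measurable_restrict_space2)
    then show ?thesis by (simp add: measurable_pair_iff)
  qed
  have "distr ?P' ?M' \<psi>' = ?M'"
  proof (rule measure_eqI)
    fix X assume "X \<in> sets (distr ?P' ?M' \<psi>')"
    then have X': "X \<in> sets ?M'" by simp
    then have X: "X \<in> sets M" "X \<subseteq> S"
      using S by (auto simp: sets_restrict_space_iff)
    have eq: "\<psi>' -` X \<inter> space ?P' = \<psi> -` X \<inter> space ?P"
      using box' agree' X(2) unfolding sp by (fastforce simp: space_pair_measure)
    have "emeasure (distr ?P' ?M' \<psi>') X = emeasure ?P' (\<psi>' -` X \<inter> space ?P')"
      by (rule emeasure_distr[OF meas' X'])
    also have "\<dots> = emeasure ?P (\<psi>' -` X \<inter> space ?P')"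
      by (rule emeasure_pair_restrict_space[OF N2 S1 S2 measurable_sets[OF meas' X']])
    also have "\<dots> = emeasure (distr ?P M \<psi>) X"
      unfolding eq by (rule emeasure_distr[OF meas X(1), symmetric])
    also have "\<dots> = emeasure ?M' X"
      using X(2) S by (simp add: distr emeasure_restrict_space)
    finally show "emeasure (distr ?P' ?M' \<psi>') X = emeasure ?M' X" .
  qed simp
  then show ?thesis
    unfolding product_chart_def sp using bij' meas' inv' by blast
qed

section \<open>Fibers of a tartan and their streamlines\<close>

lemma measured_turbulation_streamline:
  assumes "measured_turbulation \<mu> T" "(X, \<nu>) \<in> T"
  shows "immersed_line X" "stream_measure X \<nu>"
  using assms unfolding measured_turbulation_def by auto

lemma stream_measure_sets: "stream_measure X \<nu> \<Longrightarrow> sets \<nu> = sets (borel_on X)"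
  by (simp add: stream_measure_def)

lemma stream_measure_space: "stream_measure X \<nu> \<Longrightarrow> space \<nu> = topspace X"
  using sets_eq_imp_space_eq[OF stream_measure_sets] by simp

text \<open>Streamlines are disjoint and arcs are non-empty, so the definite description picks out \<open>(X, \<nu>)\<close>.\<close>

lemma measure_of_line_eq:
  assumes T: "measured_turbulation \<mu> T" and X: "(X, \<nu>) \<in> T" and A: "stream_arc X A"
  shows "measure_of_line T A = \<nu>"
proof -
  note A' = stream_arc_properties[OF A]
  have "(THE p. p \<in> T \<and> A \<subseteq> topspace (fst p)) = (X, \<nu>)"
  proof (rule the_equality)
    show "(X, \<nu>) \<in> T \<and> A \<subseteq> topspace (fst (X, \<nu>))"
      using X A'(2) by simp
    fix p assume p: "p \<in> T \<and> A \<subseteq> topspace (fst p)"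
    then have "topspace (fst p) \<inter> topspace (fst (X, \<nu>)) \<noteq> {}"
      using A'(1,2) by auto
    then show "p = (X, \<nu>)"
      using T p X unfolding measured_turbulation_def by blast
  qed
  then show ?thesis by (simp add: measure_of_line_def)
qed

lemma fiber_through_eq:
  assumes "disjoint \<A>" "A \<in> \<A>" "x \<in> A"
  shows "fiber_through \<A> x = A"
  unfolding fiber_through_def
proof (rule the_equality)
  fix B assume "B \<in> \<A> \<and> x \<in> B"
  then show "B = A"
    using assms unfolding pairwise_def disjnt_def by blast
qed (use assms in simp)

lemma tartan_disjoint:
  assumes "is_tartan Ts Tu R"
  shows "disjoint (stable_fibers R)" "disjoint (unstable_fibers R)"
  using assms unfolding is_tartan_def by - (elim conjE, assumption)+

lemma tartan_fiber_streamline: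
  assumes "is_tartan Ts Tu R"
  shows "\<forall>A\<in>stable_fibers R. \<exists>(X, \<nu>)\<in>Ts. stream_arc X A"
    and "\<forall>B\<in>unstable_fibers R. \<exists>(Y, \<nu>)\<in>Tu. stream_arc Y B"
  using assms unfolding is_tartan_def by - (elim conjE, assumption)+

lemma tartan_crossing:
  assumes "is_tartan Ts Tu R"
  shows "\<forall>A\<in>stable_fibers R. \<forall>B\<in>unstable_fibers R. \<exists>x. A \<inter> B = {x} \<and>
        (transverse_at (line_of Ts A) (line_of Tu B) x \<or>
         arc_endpoint (line_of Ts A) A x \<or> arc_endpoint (line_of Tu B) B x)"
  using assms unfolding is_tartan_def by (elim conjE)

lemma tartan_coherently_ordered:
  assumes "is_tartan Ts Tu R"
  shows "coherently_ordered Ts (stable_fibers R) (unstable_fibers R)"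
    and "coherently_ordered Tu (unstable_fibers R) (stable_fibers R)"
  using assms unfolding is_tartan_def by - (elim conjE, assumption)+

lemma tartan_bounded:
  assumes "is_tartan Ts Tu R"
  shows "\<exists>K<\<infinity>. (\<forall>A\<in>stable_fibers R. emeasure (measure_of_line Ts A) A \<le> K) \<and>
            (\<forall>B\<in>unstable_fibers R. emeasure (measure_of_line Tu B) B \<le> K)"
  using assms unfolding is_tartan_def by (elim conjE)

lemma tartan_in_disk:
  assumes "is_tartan Ts Tu R"
  shows "\<exists>D. open D \<and> D homeomorphic (ball 0 1 :: (real \<times> real) set) \<and>
        stable_part R \<union> unstable_part R \<subseteq> D"
  using assms unfolding is_tartan_def by (elim conjE)

lemma tartan_parts_borel:
  assumes "is_tartan Ts Tu R"
  shows "stable_part R \<in> sets borel" "unstable_part R \<in> sets borel" "crossing_set R \<in> sets borel"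
proof -
  show "stable_part R \<in> sets borel" "unstable_part R \<in> sets borel"
    using assms unfolding is_tartan_def by - (elim conjE, assumption)+
  then show "crossing_set R \<in> sets borel" by (simp add: crossing_set_def)
qed

lemma tartan_chart_eq:
  assumes R: "is_tartan Ts Tu R"
    and B: "B \<in> unstable_fibers R" "x \<in> B" and A: "A \<in> stable_fibers R" "y \<in> A"
  shows "A \<inter> B = {tartan_chart R (x, y)}"
proof -
  have "fiber_through (unstable_fibers R) x = B" "fiber_through (stable_fibers R) y = A"
    using fiber_through_eq tartan_disjoint[OF R] A B by metis+
  moreover obtain z where "A \<inter> B = {z}"
    using tartan_crossing[OF R] A(1) B(1) by meson
  ultimately show ?thesis
    by (simp add: tartan_chart_def Int_commute)
qed

lemma saturated_fiber_subset:
  assumes "saturated T P" "(X, \<nu>) \<in> T" "stream_arc X A" "x \<in> A" "x \<in> P"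
  shows "A \<subseteq> P"
  using assms saturated_subset[OF assms(1,2)] stream_arc_properties(2)[OF assms(3)] by blast

lemma fiber_trace_space:
  assumes T: "measured_turbulation \<mu> T" and X: "(X, \<nu>) \<in> T" and A: "stream_arc X A"
    and C: "crossing_set R \<in> sets borel"
  shows "A \<inter> crossing_set R \<in> sets \<nu>" "space (fiber_trace_measure T R A) = A \<inter> crossing_set R"
proof -
  note X' = measured_turbulation_streamline[OF T X] and A' = stream_arc_properties[OF A]
  have "A \<inter> crossing_set R = A \<inter> (crossing_set R \<inter> topspace X)"
    using A'(2) by blast
  then show "A \<inter> crossing_set R \<in> sets \<nu>"
    using A'(3) borel_Int_streamline[OF X'(1) C] stream_measure_sets[OF X'(2)] by simp
  then show "space (fiber_trace_measure T R A) = A \<inter> crossing_set R"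
    by (simp add: fiber_trace_measure_def measure_of_line_eq[OF T X A])
qed

section \<open>Subtartans cut out by saturated sets\<close>

definition subtartan :: "'a tartan \<Rightarrow> 'a set \<Rightarrow> 'a set \<Rightarrow> 'a tartan" where
  "subtartan R P Q = \<lparr>stable_fibers = {A \<in> stable_fibers R. A \<subseteq> P},
                      unstable_fibers = {B \<in> unstable_fibers R. B \<subseteq> Q}\<rparr>"

lemma coherently_ordered_subset:
  assumes "coherently_ordered T \<A> \<B>" "\<A>' \<subseteq> \<A>" "\<B>' \<subseteq> \<B>"
  shows "coherently_ordered T \<A>' \<B>'"
proof -
  from assms(1) obtain \<phi> where \<phi>: "\<forall>A\<in>\<A>. line_param (line_of T A) (\<phi> A)"
    "\<forall>A\<in>\<A>. \<forall>A'\<in>\<A>. \<forall>B\<in>\<B>. \<forall>B'\<in>\<B>. crosses_before (\<phi> A) A B B' \<longleftrightarrow> crosses_before (\<phi> A') A' B B'"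
    unfolding coherently_ordered_def by (elim exE conjE)
  show ?thesis
    unfolding coherently_ordered_def
  proof (intro exI[of _ \<phi>] conjI ballI)
    fix A assume "A \<in> \<A>'"
    then show "line_param (line_of T A) (\<phi> A)" using \<phi>(1) assms(2) by auto
  next
    fix A A' B B' assume "A \<in> \<A>'" "A' \<in> \<A>'" "B \<in> \<B>'" "B' \<in> \<B>'"
    then show "crosses_before (\<phi> A) A B B' \<longleftrightarrow> crosses_before (\<phi> A') A' B B'"
      using \<phi>(2) assms(2,3) by (meson subsetD)
  qed
qed

text \<open>A fiber meeting the saturated set is kept whole, so no point of that set is lost.\<close>

lemma subtartan_parts:
  assumes R: "is_tartan Ts Tu R" and P: "saturated Ts P" and Q: "saturated Tu Q"
  shows "stable_part (subtartan R P Q) = stable_part R \<inter> P"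
    and "unstable_part (subtartan R P Q) = unstable_part R \<inter> Q"
    and "crossing_set (subtartan R P Q) = crossing_set R \<inter> (P \<inter> Q)"
proof -
  have "A \<subseteq> P" if A: "A \<in> stable_fibers R" "x \<in> A" "x \<in> P" for A x
    using tartan_fiber_streamline(1)[OF R] A(1) saturated_fiber_subset[OF P _ _ A(2,3)] by blast
  then show s: "stable_part (subtartan R P Q) = stable_part R \<inter> P"
    by (auto simp: stable_part_def subtartan_def)
  have "B \<subseteq> Q" if B: "B \<in> unstable_fibers R" "x \<in> B" "x \<in> Q" for B x
    using tartan_fiber_streamline(2)[OF R] B(1) saturated_fiber_subset[OF Q _ _ B(2,3)] by blast
  then show u: "unstable_part (subtartan R P Q) = unstable_part R \<inter> Q"
    by (auto simp: unstable_part_def subtartan_def)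
  show "crossing_set (subtartan R P Q) = crossing_set R \<inter> (P \<inter> Q)"
    unfolding crossing_set_def s u by blast
qed

lemma is_tartan_subtartan:
  assumes R: "is_tartan Ts Tu R" and P: "saturated Ts P" "P \<in> sets borel"
    and Q: "saturated Tu Q" "Q \<in> sets borel"
  shows "is_tartan Ts Tu (subtartan R P Q)"
proof -
  let ?R = "subtartan R P Q"
  have sub: "stable_fibers ?R \<subseteq> stable_fibers R" "unstable_fibers ?R \<subseteq> unstable_fibers R"
    by (auto simp: subtartan_def)
  note parts = subtartan_parts[OF R P(1) Q(1)]
  show ?thesis
    unfolding is_tartan_def
  proof (intro conjI)
    show "stable_part ?R \<in> sets borel" "unstable_part ?R \<in> sets borel"
      unfolding parts using tartan_parts_borel[OF R] P(2) Q(2) by auto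
    show "disjoint (stable_fibers ?R)" "disjoint (unstable_fibers ?R)"
      using tartan_disjoint[OF R] sub pairwise_subset by blast+
    show "\<forall>A\<in>stable_fibers ?R. \<exists>(X, \<nu>)\<in>Ts. stream_arc X A"
      "\<forall>B\<in>unstable_fibers ?R. \<exists>(Y, \<nu>)\<in>Tu. stream_arc Y B"
      using tartan_fiber_streamline[OF R] sub by (meson subsetD)+
    show "\<forall>A\<in>stable_fibers ?R. \<forall>B\<in>unstable_fibers ?R. \<exists>x. A \<inter> B = {x} \<and>
        (transverse_at (line_of Ts A) (line_of Tu B) x \<or>
         arc_endpoint (line_of Ts A) A x \<or> arc_endpoint (line_of Tu B) B x)"
      using tartan_crossing[OF R] sub by (meson subsetD)
    show "coherently_ordered Ts (stable_fibers ?R) (unstable_fibers ?R)"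
      "coherently_ordered Tu (unstable_fibers ?R) (stable_fibers ?R)"
      using tartan_coherently_ordered[OF R] coherently_ordered_subset sub by blast+
    show "\<exists>K<\<infinity>. (\<forall>A\<in>stable_fibers ?R. emeasure (measure_of_line Ts A) A \<le> K) \<and>
            (\<forall>B\<in>unstable_fibers ?R. emeasure (measure_of_line Tu B) B \<le> K)"
      using tartan_bounded[OF R] sub by (meson subsetD)
    show "\<exists>D. open D \<and> D homeomorphic (ball 0 1 :: (real \<times> real) set) \<and>
        stable_part ?R \<union> unstable_part ?R \<subseteq> D"
      using tartan_in_disk[OF R] unfolding parts by blast
  qed
qed

text \<open>The crossing set is Borel, so its intersection with a fiber is the whole space of the trace
  measure, as the rectangle in \<open>product_chart\<close> requires.\<close>

lemma compatible_tartan_iff: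
  assumes Ts: "measured_turbulation \<mu> Ts" and Tu: "measured_turbulation \<mu> Tu" and \<mu>: "sets \<mu> = sets borel"
  shows "compatible_tartan \<mu> Ts Tu R \<longleftrightarrow>
    is_tartan Ts Tu R \<and>
    (\<forall>A\<in>stable_fibers R. \<forall>B\<in>unstable_fibers R.
       product_chart (fiber_trace_measure Ts R A) (fiber_trace_measure Tu R B)
         (restrict_space \<mu> (crossing_set R)) (tartan_chart R))"
proof (cases "is_tartan Ts Tu R")
  case R: True
  note C = tartan_parts_borel(3)[OF R]
  have [simp]: "space \<mu> = UNIV"
    using sets_eq_imp_space_eq[OF \<mu>] by simp
  have sM: "space (restrict_space \<mu> (crossing_set R)) = crossing_set R"
    by (simp add: space_restrict_space)
  have s: "space (fiber_trace_measure Ts R A) = A \<inter> crossing_set R" if "A \<in> stable_fibers R" for A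
    using tartan_fiber_streamline(1)[OF R] that fiber_trace_space(2)[OF Ts _ _ C] by blast
  have u: "space (fiber_trace_measure Tu R B) = B \<inter> crossing_set R" if "B \<in> unstable_fibers R" for B
    using tartan_fiber_streamline(2)[OF R] that fiber_trace_space(2)[OF Tu _ _ C] by blast
  show ?thesis
    using R by (simp add: compatible_tartan_def product_chart_def Let_def s u sM)
qed (simp add: compatible_tartan_def)

lemma fiber_trace_subtartan:
  assumes T: "measured_turbulation \<mu> T" and X: "(X, \<nu>) \<in> T" and A: "stream_arc X A"
    and C: "crossing_set R \<in> sets borel" and S: "S \<in> sets borel"
    and R': "A \<inter> crossing_set R' = A \<inter> crossing_set R \<inter> S"
  shows "fiber_trace_measure T R' A = restrict_space (fiber_trace_measure T R A) S"
    and "S \<inter> space (fiber_trace_measure T R A) \<in> sets (fiber_trace_measure T R A)"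
proof -
  note X' = measured_turbulation_streamline[OF T X]
  note AC = fiber_trace_space[OF T X A C]
  have \<nu>: "measure_of_line T A = \<nu>" by (rule measure_of_line_eq[OF T X A])
  have sp: "space \<nu> = topspace X" by (rule stream_measure_space[OF X'(2)])
  have SX: "S \<inter> topspace X \<in> sets \<nu>"
    using borel_Int_streamline[OF X'(1) S] stream_measure_sets[OF X'(2)] by simp
  have sub: "A \<inter> crossing_set R \<subseteq> topspace X"
    using sets.sets_into_space[OF AC(1)] sp by simp
  have eq: "S \<inter> (A \<inter> crossing_set R) = (S \<inter> topspace X) \<inter> (A \<inter> crossing_set R)"
    using sub by blast
  show "S \<inter> space (fiber_trace_measure T R A) \<in> sets (fiber_trace_measure T R A)"
    unfolding AC(2) unfolding fiber_trace_measure_def \<nu> sets_restrict_space eq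
    using SX by (intro image_eqI[of _ _ "S \<inter> topspace X"]) auto
  have "restrict_space (restrict_space \<nu> (A \<inter> crossing_set R)) S = restrict_space \<nu> (A \<inter> crossing_set R \<inter> S)"
    using AC(1) SX sub by (intro restrict_restrict_space) (auto simp: sp Int_absorb2)
  then show "fiber_trace_measure T R' A = restrict_space (fiber_trace_measure T R A) S"
    by (simp add: fiber_trace_measure_def \<nu> R')
qed

text \<open>Finiteness of the fiber measures is what allows Fubini in the restriction of charts.\<close>

lemma finite_fiber_trace:
  assumes T: "measured_turbulation \<mu> T" and X: "(X, \<nu>) \<in> T" and A: "stream_arc X A"
    and C: "crossing_set R \<in> sets borel"
    and fin: "emeasure (measure_of_line T A) A < \<infinity>"
  shows "finite_measure (fiber_trace_measure T R A)"
proof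
  have \<nu>: "measure_of_line T A = \<nu>" by (rule measure_of_line_eq[OF T X A])
  note AC = fiber_trace_space[OF T X A C]
  have "A \<in> sets \<nu>"
    using stream_arc_properties(3)[OF A] stream_measure_sets[OF measured_turbulation_streamline(2)[OF T X]] by simp
  then have "emeasure \<nu> (A \<inter> crossing_set R) < \<infinity>"
    using fin unfolding \<nu> by (meson emeasure_mono inf_le1 le_less_trans)
  moreover have "emeasure (fiber_trace_measure T R A) (A \<inter> crossing_set R) = emeasure \<nu> (A \<inter> crossing_set R)"
    unfolding fiber_trace_measure_def \<nu> using AC(1) sets.sets_into_space[OF AC(1)]
    by (intro emeasure_restrict_space) (simp_all add: Int_absorb2)
  ultimately show "emeasure (fiber_trace_measure T R A) (space (fiber_trace_measure T R A)) \<noteq> \<infinity>"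
    unfolding AC(2) by simp
qed

text \<open>The point with coordinates \<open>x\<close> and \<open>y\<close> lies on the unstable fiber through \<open>x\<close> and on the stable fiber
  through \<open>y\<close>. Saturation therefore puts it in \<open>Q\<close> exactly when \<open>x\<close> is, and in \<open>P\<close> exactly when \<open>y\<close> is: the new
  crossing set is a sub-rectangle of the old one.\<close>

lemma compatible_subtartan:
  assumes Ts: "measured_turbulation \<mu> Ts" and Tu: "measured_turbulation \<mu> Tu" and \<mu>: "sets \<mu> = sets borel"
    and comp: "compatible_tartan \<mu> Ts Tu R"
    and P: "saturated Ts P" "P \<in> sets borel" and Q: "saturated Tu Q" "Q \<in> sets borel"
  shows "compatible_tartan \<mu> Ts Tu (subtartan R P Q)"
proof -
  let ?R = "subtartan R P Q" and ?C = "crossing_set R"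
  have R: "is_tartan Ts Tu R"
    using comp by (simp add: compatible_tartan_def)
  have R': "is_tartan Ts Tu ?R"
    by (rule is_tartan_subtartan[OF R P Q])
  note C = tartan_parts_borel(3)[OF R]
  have cross: "crossing_set ?R = ?C \<inter> (P \<inter> Q)"
    by (rule subtartan_parts(3)[OF R P(1) Q(1)])
  have [simp]: "space \<mu> = UNIV"
    using sets_eq_imp_space_eq[OF \<mu>] by simp
  have "product_chart (fiber_trace_measure Ts ?R A) (fiber_trace_measure Tu ?R B)
         (restrict_space \<mu> (crossing_set ?R)) (tartan_chart ?R)"
    if A': "A \<in> stable_fibers ?R" and B': "B \<in> unstable_fibers ?R" for A B
  proof -
    from A' B' have A: "A \<in> stable_fibers R" "A \<subseteq> P" and B: "B \<in> unstable_fibers R" "B \<subseteq> Q"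
      by (auto simp: subtartan_def)
    obtain X \<nu> where X: "(X, \<nu>) \<in> Ts" "stream_arc X A"
      using tartan_fiber_streamline(1)[OF R] A(1) by blast
    obtain Y \<nu>' where Y: "(Y, \<nu>') \<in> Tu" "stream_arc Y B"
      using tartan_fiber_streamline(2)[OF R] B(1) by blast
    have "A \<inter> crossing_set ?R = A \<inter> ?C \<inter> Q" "B \<inter> crossing_set ?R = B \<inter> ?C \<inter> P"
      using A(2) B(2) unfolding cross by blast+
    note sA = fiber_trace_subtartan[OF Ts X C Q(2) this(1)]
      and sB = fiber_trace_subtartan[OF Tu Y C P(2) this(2)]
    have spA: "space (fiber_trace_measure Ts R A) = A \<inter> ?C"
      by (rule fiber_trace_space(2)[OF Ts X C])
    have spB: "space (fiber_trace_measure Tu R B) = B \<inter> ?C"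
      by (rule fiber_trace_space(2)[OF Tu Y C])
    have M: "restrict_space \<mu> (crossing_set ?R) = restrict_space (restrict_space \<mu> ?C) (P \<inter> Q)"
      unfolding cross using C P(2) Q(2) \<mu> by (simp add: restrict_restrict_space)
    have "emeasure (measure_of_line Tu B) B < \<infinity>"
      using tartan_bounded[OF R] B(1) by (meson le_less_trans)
    from finite_fiber_trace[OF Tu Y C this]
    have fin: "sigma_finite_measure (fiber_trace_measure Tu R B)"
      by (rule finite_measure.axioms(1))
    show ?thesis
      unfolding sA(1) sB(1) M
    proof (rule product_chart_restrict[OF _ fin sA(2) sB(2)])
      show "product_chart (fiber_trace_measure Ts R A) (fiber_trace_measure Tu R B)
              (restrict_space \<mu> ?C) (tartan_chart R)"
        using comp A(1) B(1) compatible_tartan_iff[OF Ts Tu \<mu>] by blast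
      show "P \<inter> Q \<inter> space (restrict_space \<mu> ?C) \<in> sets (restrict_space \<mu> ?C)"
        using C P(2) Q(2) \<mu> by (auto simp: space_restrict_space sets_restrict_space_iff)
    next
      fix x y
      assume "x \<in> space (fiber_trace_measure Ts R A)" "y \<in> space (fiber_trace_measure Tu R B)"
      then have xy: "x \<in> ?C" "y \<in> ?C" unfolding spA spB by auto
      obtain U where U: "U \<in> unstable_fibers R" "x \<in> U"
        using xy(1) by (auto simp: crossing_set_def unstable_part_def)
      obtain S where S: "S \<in> stable_fibers R" "y \<in> S"
        using xy(2) by (auto simp: crossing_set_def stable_part_def)
      have "S \<inter> U = {tartan_chart R (x, y)}"
        by (rule tartan_chart_eq[OF R U S])
      then have z: "tartan_chart R (x, y) \<in> U" "tartan_chart R (x, y) \<in> S" by blast+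
      have "tartan_chart R (x, y) \<in> P \<longleftrightarrow> y \<in> P"
        using tartan_fiber_streamline(1)[OF R] S(1) saturated_fiber_subset[OF P(1)] S(2) z(2)
        by blast
      moreover have "tartan_chart R (x, y) \<in> Q \<longleftrightarrow> x \<in> Q"
        using tartan_fiber_streamline(2)[OF R] U(1) saturated_fiber_subset[OF Q(1)] U(2) z(1)
        by blast
      ultimately show "tartan_chart R (x, y) \<in> P \<inter> Q \<longleftrightarrow> x \<in> Q \<and> y \<in> P" by blast
    next
      fix x y
      assume "x \<in> Q \<inter> space (fiber_trace_measure Ts R A)" "y \<in> P \<inter> space (fiber_trace_measure Tu R B)"
      then have "x \<in> crossing_set ?R" "y \<in> crossing_set ?R"
        using A(2) B(2) unfolding spA spB cross by auto
      then obtain U S where U: "U \<in> unstable_fibers ?R" "x \<in> U" and S: "S \<in> stable_fibers ?R" "y \<in> S"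
        by (auto simp: crossing_set_def unstable_part_def stable_part_def)
      then have "U \<in> unstable_fibers R" "S \<in> stable_fibers R"
        by (auto simp: subtartan_def)
      then show "tartan_chart ?R (x, y) = tartan_chart R (x, y)"
        using tartan_chart_eq[OF R' U S] tartan_chart_eq[OF R _ U(2) _ S(2)] by simp
    qed
  qed
  with R' show ?thesis
    using compatible_tartan_iff[OF Ts Tu \<mu>] by blast
qed

section \<open>Ergodicity\<close>

lemma streamlines_containing_subset:
  assumes T: "saturated T P" and \<A>: "\<And>A. A \<in> \<A> \<Longrightarrow> A \<noteq> {} \<and> A \<subseteq> P"
  shows "streamlines_containing T \<A> \<subseteq> P"
proof
  fix x assume "x \<in> streamlines_containing T \<A>"
  then obtain X \<nu> A where "(X, \<nu>) \<in> T" "A \<in> \<A>" "A \<subseteq> topspace X" "x \<in> topspace X"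
    by (auto simp: streamlines_containing_def)
  with \<A>[of A] saturated_subset[OF T] show "x \<in> P" by blast
qed

text \<open>Countably many crossing sets cover almost everything, so one of them meets \<open>A\<close> in positive measure.\<close>

lemma full_pair_positive_tartan:
  assumes full: "full_pair \<mu> Ts Tu" and \<mu>: "prob_space \<mu>" "sets \<mu> = sets borel"
    and A: "A \<in> sets \<mu>" "emeasure \<mu> A \<noteq> 0"
  obtains R where "compatible_tartan \<mu> Ts Tu R" "emeasure \<mu> (crossing_set R \<inter> A) \<noteq> 0"
proof -
  interpret prob_space \<mu> by fact
  obtain \<R> where \<R>: "countable \<R>" "\<And>R. R \<in> \<R> \<Longrightarrow> compatible_tartan \<mu> Ts Tu R"
    "emeasure \<mu> (\<Union>R\<in>\<R>. crossing_set R) = 1"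
    using full unfolding full_pair_def by blast
  let ?U = "\<Union>R\<in>\<R>. crossing_set R"
  have C: "crossing_set R \<in> sets \<mu>" if "R \<in> \<R>" for R
    using \<R>(2)[OF that] tartan_parts_borel(3) \<mu>(2) by (auto simp: compatible_tartan_def)
  have U: "?U \<in> sets \<mu>"
    using \<R>(1) C by (intro sets.countable_UN') auto
  then have ae: "AE x in \<mu>. x \<in> ?U"
    using \<R>(3) by (intro AE_in_set_eq_1[THEN iffD2]) (auto simp: emeasure_eq_measure)
  have "\<exists>R\<in>\<R>. emeasure \<mu> (crossing_set R \<inter> A) \<noteq> 0"
  proof (rule ccontr)
    assume "\<not> ?thesis"
    then have "(\<Union>R\<in>\<R>. crossing_set R \<inter> A) \<in> null_sets \<mu>"
      using C A(1) by (intro null_sets_UN' \<R>(1)) auto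
    then have "AE x in \<mu>. x \<notin> (\<Union>R\<in>\<R>. crossing_set R \<inter> A)"
      by (rule AE_not_in)
    with ae have "AE x in \<mu>. x \<notin> A" by eventually_elim auto
    then show False
      using A AE_iff_null_sets[OF A(1)] by auto
  qed
  with \<R>(2) that show thesis by blast
qed

lemma measure_preserving_inv:
  assumes "measure_preserving M F" "bij F" "inv F \<in> measurable M M"
  shows "measure_preserving M (inv F)"
proof -
  have F: "F \<in> measurable M M" "distr M M F = M"
    using assms(1) by (auto simp: measure_preserving_def)
  have "distr M M (inv F) = distr (distr M M F) M (inv F)"
    by (simp add: F)
  also have "\<dots> = distr M M (inv F \<circ> F)"
    by (rule distr_distr[OF assms(3) F(1)])
  also have "inv F \<circ> F = (\<lambda>x. x)"
    using assms(2) by (simp add: bij_is_inj id_def)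
  finally show ?thesis
    using assms(3) by (simp add: measure_preserving_def distr_id)
qed

theorem theorem7p5:
  fixes \<mu> :: "'a::metric_space measure"
    and F :: "'a \<Rightarrow> 'a"
    and Ts Tu :: "'a turbulation"
    and c :: real
  assumes "compact_surface TYPE('a)"
    and "OU_measure \<mu>"
    and "prob_space \<mu>"
    and "measurable_pseudo_Anosov \<mu> F Ts Tu c"
    and "tartan_connection_hypothesis \<mu> Ts Tu"
  shows "ergodic \<mu> F"
proof -
  interpret prob_space \<mu> by fact
  have cpt: "compact (UNIV :: 'a set)"
    using assms(1) by (simp add: compact_surface_def)
  have \<mu>: "sets \<mu> = sets borel"
    using assms(2) by (simp add: OU_measure_def)
  have [simp]: "space \<mu> = UNIV"
    using sets_eq_imp_space_eq[OF \<mu>] by simp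
  have hom: "homeomorphic_map euclidean euclidean F" and mp: "measure_preserving \<mu> F"
    and Ts: "measured_turbulation \<mu> Ts" "tame Ts" and Tu: "measured_turbulation \<mu> Tu" "tame Tu"
    and full: "full_pair \<mu> Ts Tu" and c: "1 < c"
    and inv_s: "image_turbulation F Ts = scale_turbulation c Ts"
    and inv_u: "image_turbulation F Tu = scale_turbulation (inverse c) Tu"
    using assms(4) by (auto simp: measurable_pseudo_Anosov_def pseudo_Anosov_turbulations_def)
  have bij: "bij F" and contF: "continuous_on UNIV F"
    using hom by (auto simp: homeomorphic_eq_everything_map bij_def)
  have contG: "continuous_on UNIV (inv F)"
  proof -
    obtain G where G: "homeomorphic_maps euclidean euclidean F G"
      using hom by (auto simp: homeomorphic_map_maps)
    then have "inv F = G"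
      by (intro inv_equality) (auto simp: homeomorphic_maps_def)
    with G show ?thesis by (simp add: homeomorphic_maps_def)
  qed
  have mpG: "measure_preserving \<mu> (inv F)"
    using borel_measurable_continuous_onI[OF contG]
    by (intro measure_preserving_inv[OF mp bij]) (simp add: measurable_cong_sets[OF \<mu> \<mu>])
  have contr_s: "streamwise_contraction Ts F c"
    using stream_measure_sets[OF measured_turbulation_streamline(2)[OF Ts(1)]]
    by (intro streamwise_contraction_forward[OF bij contF _ inv_s]) simp_all
  have contr_u: "streamwise_contraction Tu (inv F) c"
    using c stream_measure_sets[OF measured_turbulation_streamline(2)[OF Tu(1)]]
    by (intro streamwise_contraction_backward[OF bij contG _ _ inv_u]) simp_all
  show ?thesis
    unfolding ergodic_def
  proof (intro conjI ballI impI mp)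
    fix A assume A: "A \<in> sets \<mu>" and "F -` A \<inter> space \<mu> = A"
    then have FA: "F -` A = A" by simp
    then have GA: "inv F -` A = A"
      using bij by (metis bij_vimage_eq_inv_image bij_imp_bij_inv inv_inv_eq bij_is_surj surj_image_vimage_eq)
    obtain P where P: "P \<in> sets \<mu>" "saturated Ts P" "AE x in \<mu>. x \<in> P \<longleftrightarrow> x \<in> A"
      using saturated_representative[OF cpt \<mu> finite_measure_axioms _ Ts(2) contr_s c mp A FA]
        measured_turbulation_streamline[OF Ts(1)] by blast
    obtain Q where Q: "Q \<in> sets \<mu>" "saturated Tu Q" "AE x in \<mu>. x \<in> Q \<longleftrightarrow> x \<in> A"
      using saturated_representative[OF cpt \<mu> finite_measure_axioms _ Tu(2) contr_u c mpG A GA]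
        measured_turbulation_streamline[OF Tu(1)] by blast
    show "emeasure \<mu> A = 0 \<or> emeasure \<mu> (space \<mu> - A) = 0"
    proof (rule ccontr)
      assume "\<not> ?thesis"
      then have pos: "emeasure \<mu> A \<noteq> 0" "emeasure \<mu> (- A) \<noteq> 0"
        by (auto simp: Compl_eq_Diff_UNIV)
      have nA: "- A \<in> sets \<mu>" and nQ: "- Q \<in> sets \<mu>"
        using A Q(1) sets.compl_sets[of _ \<mu>] by (simp_all add: Compl_eq_Diff_UNIV)
      obtain R where R: "compatible_tartan \<mu> Ts Tu R" "emeasure \<mu> (crossing_set R \<inter> A) \<noteq> 0"
        using full_pair_positive_tartan[OF full assms(3) \<mu> A pos(1)] .
      obtain S where S: "compatible_tartan \<mu> Ts Tu S" "emeasure \<mu> (crossing_set S \<inter> - A) \<noteq> 0"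
        using full_pair_positive_tartan[OF full assms(3) \<mu> nA pos(2)] .
      have tR: "is_tartan Ts Tu R" and tS: "is_tartan Ts Tu S"
        using R(1) S(1) by (simp_all add: compatible_tartan_def)
      have CR: "crossing_set R \<in> sets \<mu>" and CS: "crossing_set S \<in> sets \<mu>"
        using tartan_parts_borel(3)[OF tR] tartan_parts_borel(3)[OF tS] \<mu> by simp_all
      let ?R = "subtartan R P UNIV" and ?S = "subtartan S UNIV (- Q)"
      have UNIV_sat: "saturated T UNIV" for T :: "'a turbulation"
        by (simp add: saturated_def case_prod_beta)
      note Qc = saturated_Compl[OF Q(2)]
      have comp: "compatible_tartan \<mu> Ts Tu ?R" "compatible_tartan \<mu> Ts Tu ?S"
        using P Q(1) nQ \<mu> UNIV_sat Qc
        by (auto intro!: compatible_subtartan[OF Ts(1) Tu(1) \<mu>] R(1) S(1))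
      have "emeasure \<mu> (crossing_set ?R) = emeasure \<mu> (crossing_set R \<inter> A)"
        unfolding subtartan_parts(3)[OF tR P(2) UNIV_sat]
        using CR P(1,3) A by (intro emeasure_eq_AE) auto
      then have posR: "positive_measure_tartan \<mu> ?R"
        using R(2) by (simp add: positive_measure_tartan_def zero_less_iff_neq_zero)
      have "emeasure \<mu> (crossing_set ?S) = emeasure \<mu> (crossing_set S \<inter> - A)"
        unfolding subtartan_parts(3)[OF tS UNIV_sat Qc]
        using CS nQ nA Q(3) by (intro emeasure_eq_AE) auto
      then have posS: "positive_measure_tartan \<mu> ?S"
        using S(2) by (simp add: positive_measure_tartan_def zero_less_iff_neq_zero)
      \<comment> \<open>The streamlines that the connection hypothesis joins stay in \<open>P\<close> and outside \<open>Q\<close>.\<close>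
      let ?Z = "streamlines_containing Ts (stable_fibers ?R) \<inter> streamlines_containing Tu (unstable_fibers ?S)"
      have "streamlines_containing Ts (stable_fibers ?R) \<subseteq> P"
        using tartan_fiber_streamline(1)[OF tR] stream_arc_properties(1)
        by (intro streamlines_containing_subset[OF P(2)]) (fastforce simp: subtartan_def)
      moreover have "streamlines_containing Tu (unstable_fibers ?S) \<subseteq> - Q"
        using tartan_fiber_streamline(2)[OF tS] stream_arc_properties(1)
        by (intro streamlines_containing_subset[OF Qc]) (fastforce simp: subtartan_def)
      ultimately have "outer_measure_of \<mu> ?Z \<le> outer_measure_of \<mu> (P \<inter> - Q)"
        by (intro outer_measure_of_mono) blast
      also have "\<dots> = emeasure \<mu> (P \<inter> - Q)"
        using P(1) nQ by (intro outer_measure_of_eq) auto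
      also have "\<dots> = emeasure \<mu> {}"
        using P(1) nQ P(3) Q(3) by (intro emeasure_eq_AE) auto
      finally have "outer_measure_of \<mu> ?Z = 0"
        by simp
      moreover have "0 < outer_measure_of \<mu> ?Z"
        using assms(5) comp posR posS unfolding tartan_connection_hypothesis_def by blast
      ultimately show False by simp
    qed
  qed
qed

end
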